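(* Let $M$ be a free module of finite rank $n \ge 2$ over a commutative DVD. Every non-injective endomorphism $\alpha$ of $M$ is a product of $2n-2$ or fewer coprimitive idempotents of the endomorphism ring $\mathrm{End}(M)$.
   Context: A DVD (discrete valuation domain) is a commutative PID with a unique maximal ideal, generated by a non-zero prime element. $\mathrm{End}(M)$ is the ring of linear endomorphisms of $M$ under pointwise addition and composition. An idempotent $e$ of a ring $R$ is coprimitive if its right annihilator $\{x \in R : ex = 0\}$ is an indecomposable submodule of the right module $R_R$ (non-zero and not the direct sum of two non-zero submodules). *)

theory Defs
  imports "HOL-Algebra.Ring_Divisibility" "HOL-Algebra.Module"
begin

locale discrete_valuation_domain = principal_domain R for R (structure) +
  assumes unique_maximalideal:
    "\<exists>p \<in> carrier R. ring_prime p \<and> {I. maximalideal I R} = {PIdl p}"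

definition finite_basis ::
  "('a, 'r) ring_scheme \<Rightarrow> ('a, 'b, 'm) module_scheme \<Rightarrow> 'b set \<Rightarrow> bool"
  where "finite_basis R M B \<longleftrightarrow>
    finite B \<and> B \<subseteq> carrier M \<and>
    (\<forall>x \<in> carrier M. \<exists>a \<in> B \<rightarrow> carrier R. x = (\<Oplus>\<^bsub>M\<^esub>b\<in>B. a b \<odot>\<^bsub>M\<^esub> b)) \<and>
    (\<forall>a \<in> B \<rightarrow> carrier R. (\<Oplus>\<^bsub>M\<^esub>b\<in>B. a b \<odot>\<^bsub>M\<^esub> b) = \<zero>\<^bsub>M\<^esub> \<longrightarrow> (\<forall>b\<in>B. a b = \<zero>\<^bsub>R\<^esub>))"

definition free_of_rank ::
  "('a, 'r) ring_scheme \<Rightarrow> ('a, 'b, 'm) module_scheme \<Rightarrow> nat \<Rightarrow> bool"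
  where "free_of_rank R M n \<longleftrightarrow> (\<exists>B. finite_basis R M B \<and> card B = n)"

text \<open>Endomorphisms are taken extensional on the carrier, so that equality in the
  endomorphism ring is equality of maps on \<^term>\<open>carrier M\<close>. The product
  is composition of maps written on the left: \<open>f \<otimes> g\<close> applies \<open>g\<close> first.\<close>

definition module_endos ::
  "('a, 'r) ring_scheme \<Rightarrow> ('a, 'b, 'm) module_scheme \<Rightarrow> ('b \<Rightarrow> 'b) set"
  where "module_endos R M =
    {f \<in> carrier M \<rightarrow>\<^sub>E carrier M.
      (\<forall>x \<in> carrier M. \<forall>y \<in> carrier M. f (x \<oplus>\<^bsub>M\<^esub> y) = f x \<oplus>\<^bsub>M\<^esub> f y) \<and>
      (\<forall>r \<in> carrier R. \<forall>x \<in> carrier M. f (r \<odot>\<^bsub>M\<^esub> x) = r \<odot>\<^bsub>M\<^esub> f x)}"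

definition End_ring ::
  "('a, 'r) ring_scheme \<Rightarrow> ('a, 'b, 'm) module_scheme \<Rightarrow> ('b \<Rightarrow> 'b) ring"
  where "End_ring R M =
    \<lparr>carrier = module_endos R M,
     mult = compose (carrier M),
     one = (\<lambda>x \<in> carrier M. x),
     zero = (\<lambda>x \<in> carrier M. \<zero>\<^bsub>M\<^esub>),
     add = (\<lambda>f g. \<lambda>x \<in> carrier M. f x \<oplus>\<^bsub>M\<^esub> g x)\<rparr>"

lemma (in module) End_ring_is_ring: "ring (End_ring R M)"
proof -
  have ex: "f \<in> extensional (carrier M)" if "f \<in> module_endos R M" for f
    using that unfolding module_endos_def by (auto simp: PiE_def)
  have cl: "f x \<in> carrier M" if "f \<in> module_endos R M" "x \<in> carrier M" for f x
    using that unfolding module_endos_def by blast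
  have ad: "f (x \<oplus>\<^bsub>M\<^esub> y) = f x \<oplus>\<^bsub>M\<^esub> f y"
    if "f \<in> module_endos R M" "x \<in> carrier M" "y \<in> carrier M" for f x y
    using that unfolding module_endos_def by blast
  have sm: "f (r \<odot>\<^bsub>M\<^esub> x) = r \<odot>\<^bsub>M\<^esub> f x"
    if "f \<in> module_endos R M" "r \<in> carrier R" "x \<in> carrier M" for f r x
    using that unfolding module_endos_def by blast
  have endoI: "(\<lambda>x \<in> carrier M. h x) \<in> module_endos R M"
    if "\<And>x. x \<in> carrier M \<Longrightarrow> h x \<in> carrier M"
      "\<And>x y. x \<in> carrier M \<Longrightarrow> y \<in> carrier M \<Longrightarrow> h (x \<oplus>\<^bsub>M\<^esub> y) = h x \<oplus>\<^bsub>M\<^esub> h y"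
      "\<And>r x. r \<in> carrier R \<Longrightarrow> x \<in> carrier M \<Longrightarrow> h (r \<odot>\<^bsub>M\<^esub> x) = r \<odot>\<^bsub>M\<^esub> h x" for h
    using that unfolding module_endos_def by auto
  have add_cl: "(\<lambda>x \<in> carrier M. f x \<oplus>\<^bsub>M\<^esub> g x) \<in> module_endos R M"
    if "f \<in> module_endos R M" "g \<in> module_endos R M" for f g
    using that by (intro endoI) (auto simp: cl ad sm smult_r_distr M.a_ac)
  have zero_cl: "(\<lambda>x \<in> carrier M. \<zero>\<^bsub>M\<^esub>) \<in> module_endos R M"
    by (intro endoI) auto
  have one_cl: "(\<lambda>x \<in> carrier M. x) \<in> module_endos R M"
    by (intro endoI) auto
  have neg_cl: "(\<lambda>x \<in> carrier M. \<ominus>\<^bsub>M\<^esub> f x) \<in> module_endos R M"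
    if "f \<in> module_endos R M" for f
    using that by (intro endoI) (auto simp: cl ad sm smult_r_minus M.minus_add)
  have mult_cl: "compose (carrier M) f g \<in> module_endos R M"
    if "f \<in> module_endos R M" "g \<in> module_endos R M" for f g
    unfolding compose_def using that by (intro endoI) (auto simp: cl ad sm)
  show ?thesis
  proof (rule ringI)
    show "abelian_group (End_ring R M)"
    proof (rule abelian_groupI)
      fix f assume f: "f \<in> carrier (End_ring R M)"
      then have "(\<lambda>x \<in> carrier M. \<ominus>\<^bsub>M\<^esub> f x) \<oplus>\<^bsub>End_ring R M\<^esub> f = \<zero>\<^bsub>End_ring R M\<^esub>"
        unfolding End_ring_def by (auto simp: cl M.l_neg intro!: restrict_ext)
      moreover have "(\<lambda>x \<in> carrier M. \<ominus>\<^bsub>M\<^esub> f x) \<in> carrier (End_ring R M)"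
        using f neg_cl by (simp add: End_ring_def)
      ultimately show "\<exists>g\<in>carrier (End_ring R M). g \<oplus>\<^bsub>End_ring R M\<^esub> f = \<zero>\<^bsub>End_ring R M\<^esub>"
        by blast
    qed (auto simp: End_ring_def add_cl zero_cl cl ex M.a_ac
        intro!: extensionalityI[of _ "carrier M"])
    show "monoid (End_ring R M)"
      by (rule monoidI)
        (auto simp: End_ring_def mult_cl one_cl cl ex compose_eq
          intro!: extensionalityI[of _ "carrier M"])
  qed (auto simp: End_ring_def cl ad compose_eq intro!: extensionalityI[of _ "carrier M"])
qed

text \<open>The submodules of the right regular module \<open>R\<^sub>R\<close>.\<close>

definition right_ideal :: "'a set \<Rightarrow> ('a, 'r) ring_scheme \<Rightarrow> bool"
  where "right_ideal I R \<longleftrightarrow>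
    additive_subgroup I R \<and> (\<forall>x \<in> I. \<forall>r \<in> carrier R. x \<otimes>\<^bsub>R\<^esub> r \<in> I)"

definition indecomposable_right_ideal :: "'a set \<Rightarrow> ('a, 'r) ring_scheme \<Rightarrow> bool"
  where "indecomposable_right_ideal I R \<longleftrightarrow>
    right_ideal I R \<and> I \<noteq> {\<zero>\<^bsub>R\<^esub>} \<and>
    \<not> (\<exists>J K. right_ideal J R \<and> right_ideal K R \<and> J \<noteq> {\<zero>\<^bsub>R\<^esub>} \<and> K \<noteq> {\<zero>\<^bsub>R\<^esub>} \<and>
         J \<inter> K = {\<zero>\<^bsub>R\<^esub>} \<and> J <+>\<^bsub>R\<^esub> K = I)"

definition right_annihilator :: "('a, 'r) ring_scheme \<Rightarrow> 'a \<Rightarrow> 'a set"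
  where "right_annihilator R e = {x \<in> carrier R. e \<otimes>\<^bsub>R\<^esub> x = \<zero>\<^bsub>R\<^esub>}"

definition coprimitive_idempotent :: "('a, 'r) ring_scheme \<Rightarrow> 'a \<Rightarrow> bool"
  where "coprimitive_idempotent R e \<longleftrightarrow>
    e \<in> carrier R \<and> e \<otimes>\<^bsub>R\<^esub> e = e \<and> indecomposable_right_ideal (right_annihilator R e) R"

end

theory Submission
  imports Defs
begin

text \<open>
  The idempotents used are \<open>m \<mapsto> m - p(m) k\<close> for a functional \<open>p\<close> and a vector \<open>k\<close> with
  \<open>p(k) = 1\<close>; their right annihilators consist of the maps with image in the line of \<open>k\<close>, and
  any two non-zero right ideals contained there meet.

  The only property of the base ring that matters is that divisibility is total on the domain:
  every non-zero vector of a free module is then a multiple of a vector on which some coordinate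
  functional takes the value \<open>1\<close>.

  The factorisation goes by induction on the rank. If \<open>\<alpha> x = 0\<close> and \<open>N\<close> is a complement of the
  line of \<open>x\<close>, then \<open>\<alpha> = (1 \<oplus> D) e\<close>, where \<open>D\<close> is the endomorphism of \<open>N\<close> induced by \<open>\<alpha>\<close>
  modulo \<open>x\<close> and \<open>e\<close> is an idempotent with kernel the line of \<open>x\<close>. The induction applies to
  \<open>D\<close> if \<open>D\<close> is singular, which holds as soon as \<open>\<alpha> y\<close> is a multiple of \<open>x\<close> for some \<open>y\<close>
  outside the line of \<open>x\<close>. One more idempotent achieves this: if \<open>\<alpha> k = 0\<close>,
  \<open>p(k) = p(x) = 1\<close>, \<open>p(y) = 0\<close> and \<open>\<alpha> y = c x\<close>, then \<open>\<alpha> = \<alpha>' (1 - p k)\<close> with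
  \<open>\<alpha>' = \<alpha> (1 - p x)\<close>, and \<open>\<alpha>'\<close> kills \<open>x\<close> and still sends \<open>y\<close> to \<open>c x\<close>. So each rank step
  costs two idempotents, and a singular endomorphism in rank two is a product of two.
\<close>

section \<open>Modules over a domain with total divisibility\<close>

context abelian_group
begin

text \<open>Sorting a sum by associativity and commutativity can leave a term and its negative
  separated. These rules cancel such a pair across one or two other summands, at the end of the sum
  or before a further term, so that the simplifier can settle short linear identities.\<close>

lemma add_cancel_apart:
  assumes "a \<in> carrier G" "b \<in> carrier G" "c \<in> carrier G" "d \<in> carrier G"
  shows "a \<oplus> (b \<oplus> \<ominus> a) = b"
    and "\<ominus> a \<oplus> (b \<oplus> a) = b"
    and "a \<oplus> (b \<oplus> (\<ominus> a \<oplus> c)) = b \<oplus> c"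
    and "\<ominus> a \<oplus> (b \<oplus> (a \<oplus> c)) = b \<oplus> c"
    and "a \<oplus> (b \<oplus> (c \<oplus> \<ominus> a)) = b \<oplus> c"
    and "\<ominus> a \<oplus> (b \<oplus> (c \<oplus> a)) = b \<oplus> c"
    and "a \<oplus> (b \<oplus> (c \<oplus> (\<ominus> a \<oplus> d))) = b \<oplus> (c \<oplus> d)"
    and "\<ominus> a \<oplus> (b \<oplus> (c \<oplus> (a \<oplus> d))) = b \<oplus> (c \<oplus> d)"
proof -
  have 1: "a \<oplus> (b \<oplus> y) = b \<oplus> (a \<oplus> y)" "a \<oplus> (c \<oplus> y) = c \<oplus> (a \<oplus> y)"
    "\<ominus> a \<oplus> (b \<oplus> y) = b \<oplus> (\<ominus> a \<oplus> y)" "\<ominus> a \<oplus> (c \<oplus> y) = c \<oplus> (\<ominus> a \<oplus> y)"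
    if "y \<in> carrier G" for y
    using that assms a_lcomm by auto
  show "a \<oplus> (b \<oplus> \<ominus> a) = b" "\<ominus> a \<oplus> (b \<oplus> a) = b"
    "a \<oplus> (b \<oplus> (\<ominus> a \<oplus> c)) = b \<oplus> c" "\<ominus> a \<oplus> (b \<oplus> (a \<oplus> c)) = b \<oplus> c"
    "a \<oplus> (b \<oplus> (c \<oplus> \<ominus> a)) = b \<oplus> c" "\<ominus> a \<oplus> (b \<oplus> (c \<oplus> a)) = b \<oplus> c"
    "a \<oplus> (b \<oplus> (c \<oplus> (\<ominus> a \<oplus> d))) = b \<oplus> (c \<oplus> d)"
    "\<ominus> a \<oplus> (b \<oplus> (c \<oplus> (a \<oplus> d))) = b \<oplus> (c \<oplus> d)"
    using assms by (simp_all add: 1 r_neg l_neg r_neg1 r_neg2)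
qed

end

locale valuation_domain_module = module R M + domain R for R (structure) and M (structure) +
  assumes divides_total: "a \<in> carrier R \<Longrightarrow> b \<in> carrier R \<Longrightarrow> a divides b \<or> b divides a"
begin

text \<open>Expands scalars and vectors into sorted sums of monomials and cancels opposite terms.
  The flipped \<open>smult_assoc1\<close> merges nested scalars into one coefficient.\<close>

lemmas lin_simps =
  smult_l_distr smult_r_distr smult_assoc1[symmetric] smult_l_minus smult_r_minus
  R.l_distr R.r_distr R.l_minus R.r_minus R.minus_add R.minus_minus R.m_ac
  R.a_ac R.r_neg R.l_neg R.r_neg1 R.r_neg2 R.add_cancel_apart
  M.minus_add M.minus_minus M.a_ac M.r_neg M.l_neg M.r_neg1 M.r_neg2 M.add_cancel_apart

text \<open>The ring is local: \<open>a \<otimes> b\<close> and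
  \<open>\<one> \<oplus> \<ominus> (a \<otimes> b)\<close> sum to one, so whichever of them divides
  the other divides one. If it is the product, its factor \<open>a\<close> is a unit as
  well.\<close>

lemma unit_or_one_minus_mult_unit:
  assumes "a \<in> carrier R" "b \<in> carrier R"
  shows "a \<in> Units R \<or> \<one> \<oplus> \<ominus> (a \<otimes> b) \<in> Units R"
proof -
  let ?c = "\<one> \<oplus> \<ominus> (a \<otimes> b)"
  have "a \<otimes> b divides ?c \<or> ?c divides a \<otimes> b"
    using assms by (intro divides_total) auto
  then show ?thesis
  proof
    assume "a \<otimes> b divides ?c"
    then obtain d where d: "d \<in> carrier R" "?c = a \<otimes> b \<otimes> d"
      unfolding factor_def using assms by auto
    have "\<one> = a \<otimes> b \<oplus> ?c" using assms by (simp add: lin_simps)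
    also have "\<dots> = a \<otimes> (b \<otimes> (\<one> \<oplus> d))" using assms d by (simp add: lin_simps)
    finally show ?thesis
      using assms d by (metis R.m_closed R.one_closed R.a_closed R.Units_one_closed R.unit_factor)
  next
    assume "?c divides a \<otimes> b"
    then obtain d where d: "d \<in> carrier R" "a \<otimes> b = ?c \<otimes> d"
      unfolding factor_def using assms by auto
    have "\<one> = a \<otimes> b \<oplus> ?c" using assms by (simp add: lin_simps)
    also have "\<dots> = ?c \<otimes> d \<oplus> ?c" using d(2) by simp
    also have "\<dots> = ?c \<otimes> (\<one> \<oplus> d)" using assms d(1) by (simp add: lin_simps)
    finally show ?thesis
      using assms d(1) by (metis R.m_closed R.one_closed R.a_closed R.a_inv_closed R.Units_one_closed R.unit_factor)
  qed
qed

section \<open>Functionals and endomorphisms on submodules\<close>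

definition functional_on :: "'c set \<Rightarrow> ('c \<Rightarrow> 'a) \<Rightarrow> bool"
  where "functional_on N f \<longleftrightarrow> f \<in> N \<rightarrow> carrier R \<and>
    (\<forall>x\<in>N. \<forall>y\<in>N. f (x \<oplus>\<^bsub>M\<^esub> y) = f x \<oplus> f y) \<and>
    (\<forall>r\<in>carrier R. \<forall>x\<in>N. f (r \<odot>\<^bsub>M\<^esub> x) = r \<otimes> f x)"

text \<open>Only values on \<open>N\<close> are constrained. The induction on the rank moves to
  submodules inside the same carrier, and one function can then serve on all of them without being
  restricted.\<close>

definition endo_on :: "'c set \<Rightarrow> ('c \<Rightarrow> 'c) \<Rightarrow> bool"
  where "endo_on N f \<longleftrightarrow> f \<in> N \<rightarrow> N \<and>
    (\<forall>x\<in>N. \<forall>y\<in>N. f (x \<oplus>\<^bsub>M\<^esub> y) = f x \<oplus>\<^bsub>M\<^esub> f y) \<and>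
    (\<forall>r\<in>carrier R. \<forall>x\<in>N. f (r \<odot>\<^bsub>M\<^esub> x) = r \<odot>\<^bsub>M\<^esub> f x)"

lemma functional_onD:
  assumes "functional_on N f"
  shows "x \<in> N \<Longrightarrow> f x \<in> carrier R"
    and "x \<in> N \<Longrightarrow> y \<in> N \<Longrightarrow> f (x \<oplus>\<^bsub>M\<^esub> y) = f x \<oplus> f y"
    and "r \<in> carrier R \<Longrightarrow> x \<in> N \<Longrightarrow> f (r \<odot>\<^bsub>M\<^esub> x) = r \<otimes> f x"
  using assms unfolding functional_on_def by auto

lemma functional_onI:
  assumes "\<And>x. x \<in> N \<Longrightarrow> f x \<in> carrier R"
    and "\<And>x y. x \<in> N \<Longrightarrow> y \<in> N \<Longrightarrow> f (x \<oplus>\<^bsub>M\<^esub> y) = f x \<oplus> f y"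
    and "\<And>r x. r \<in> carrier R \<Longrightarrow> x \<in> N \<Longrightarrow> f (r \<odot>\<^bsub>M\<^esub> x) = r \<otimes> f x"
  shows "functional_on N f"
  using assms by (simp add: functional_on_def)

lemma endo_onD:
  assumes "endo_on N f"
  shows "x \<in> N \<Longrightarrow> f x \<in> N"
    and "x \<in> N \<Longrightarrow> y \<in> N \<Longrightarrow> f (x \<oplus>\<^bsub>M\<^esub> y) = f x \<oplus>\<^bsub>M\<^esub> f y"
    and "r \<in> carrier R \<Longrightarrow> x \<in> N \<Longrightarrow> f (r \<odot>\<^bsub>M\<^esub> x) = r \<odot>\<^bsub>M\<^esub> f x"
  using assms unfolding endo_on_def by auto

lemma submoduleD:
  assumes "submodule N R M"
  shows "x \<in> N \<Longrightarrow> x \<in> carrier M"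
    and "\<zero>\<^bsub>M\<^esub> \<in> N"
    and "r \<in> carrier R \<Longrightarrow> x \<in> N \<Longrightarrow> r \<odot>\<^bsub>M\<^esub> x \<in> N"
    and "x \<in> N \<Longrightarrow> y \<in> N \<Longrightarrow> x \<oplus>\<^bsub>M\<^esub> y \<in> N"
    and "x \<in> N \<Longrightarrow> \<ominus>\<^bsub>M\<^esub> x \<in> N"
proof -
  show "\<zero>\<^bsub>M\<^esub> \<in> N"
    using submodule.axioms(1)[OF assms] subgroup.one_closed by fastforce
qed (use submoduleE[OF assms] in auto)

lemma functional_on_zero:
  assumes "submodule N R M" "functional_on N f"
  shows "f \<zero>\<^bsub>M\<^esub> = \<zero>"
proof -
  have "f (\<zero> \<odot>\<^bsub>M\<^esub> \<zero>\<^bsub>M\<^esub>) = \<zero> \<otimes> f \<zero>\<^bsub>M\<^esub>"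
    using assms by (intro functional_onD(3)) (auto intro: submoduleD)
  then show ?thesis using functional_onD(1)[OF assms(2) submoduleD(2)[OF assms(1)]] by simp
qed

lemma functional_on_minus:
  assumes "submodule N R M" "functional_on N f" "x \<in> N"
  shows "f (\<ominus>\<^bsub>M\<^esub> x) = \<ominus> f x"
proof -
  have "x \<in> carrier M" using assms submoduleD by blast
  then have "\<ominus>\<^bsub>M\<^esub> x = (\<ominus> \<one>) \<odot>\<^bsub>M\<^esub> x" by (simp add: smult_l_minus)
  then show ?thesis
    using functional_onD[OF assms(2)] assms(3) by (simp add: R.l_minus)
qed

lemma endo_on_zero:
  assumes "submodule N R M" "endo_on N f"
  shows "f \<zero>\<^bsub>M\<^esub> = \<zero>\<^bsub>M\<^esub>"
proof -
  have "f (\<zero> \<odot>\<^bsub>M\<^esub> \<zero>\<^bsub>M\<^esub>) = \<zero> \<odot>\<^bsub>M\<^esub> f \<zero>\<^bsub>M\<^esub>"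
    using assms by (intro endo_onD(3)) (auto intro: submoduleD)
  moreover have "f \<zero>\<^bsub>M\<^esub> \<in> carrier M"
    using assms endo_onD(1) submoduleD by metis
  ultimately show ?thesis by simp
qed

lemma endo_on_minus:
  assumes "submodule N R M" "endo_on N f" "x \<in> N"
  shows "f (\<ominus>\<^bsub>M\<^esub> x) = \<ominus>\<^bsub>M\<^esub> f x"
proof -
  have "x \<in> carrier M" "f x \<in> carrier M"
    using assms submoduleD endo_onD by metis+
  then have "\<ominus>\<^bsub>M\<^esub> x = (\<ominus> \<one>) \<odot>\<^bsub>M\<^esub> x" "\<ominus>\<^bsub>M\<^esub> f x = (\<ominus> \<one>) \<odot>\<^bsub>M\<^esub> f x"
    by (simp_all add: smult_l_minus)
  then show ?thesis
    using endo_onD[OF assms(2)] assms(3) by simp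
qed

definition kernel_on :: "'c set \<Rightarrow> ('c \<Rightarrow> 'a) \<Rightarrow> 'c set"
  where "kernel_on N f = {x \<in> N. f x = \<zero>}"

lemma submodule_kernel_on:
  assumes "submodule N R M" "functional_on N f"
  shows "submodule (kernel_on N f) R M"
  by (rule submoduleI)
    (use submoduleD[OF assms(1)] functional_onD[OF assms(2)] functional_on_minus[OF assms]
      functional_on_zero[OF assms] in \<open>auto simp: kernel_on_def\<close>)

lemma functional_on_subset: "functional_on N f \<Longrightarrow> N' \<subseteq> N \<Longrightarrow> functional_on N' f"
  unfolding functional_on_def by blast

section \<open>Projections along a vector\<close>

definition project :: "('c \<Rightarrow> 'a) \<Rightarrow> 'c \<Rightarrow> 'c \<Rightarrow> 'c"
  where "project p k m = m \<oplus>\<^bsub>M\<^esub> (\<ominus> p m) \<odot>\<^bsub>M\<^esub> k"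

lemma endo_on_project:
  assumes N: "submodule N R M" and p: "functional_on N p" and k: "k \<in> N"
  shows "endo_on N (project p k)"
  unfolding endo_on_def project_def
proof (intro conjI ballI funcsetI)
  note D = submoduleD[OF N] functional_onD[OF p]
  show "m \<oplus>\<^bsub>M\<^esub> (\<ominus> p m) \<odot>\<^bsub>M\<^esub> k \<in> N" if "m \<in> N" for m
    using that k by (auto intro: D)
  show "x \<oplus>\<^bsub>M\<^esub> y \<oplus>\<^bsub>M\<^esub> (\<ominus> p (x \<oplus>\<^bsub>M\<^esub> y)) \<odot>\<^bsub>M\<^esub> k
      = x \<oplus>\<^bsub>M\<^esub> (\<ominus> p x) \<odot>\<^bsub>M\<^esub> k \<oplus>\<^bsub>M\<^esub> (y \<oplus>\<^bsub>M\<^esub> (\<ominus> p y) \<odot>\<^bsub>M\<^esub> k)" if "x \<in> N" "y \<in> N" for x y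
    using that k D by (simp add: lin_simps)
  show "r \<odot>\<^bsub>M\<^esub> x \<oplus>\<^bsub>M\<^esub> (\<ominus> p (r \<odot>\<^bsub>M\<^esub> x)) \<odot>\<^bsub>M\<^esub> k
      = r \<odot>\<^bsub>M\<^esub> (x \<oplus>\<^bsub>M\<^esub> (\<ominus> p x) \<odot>\<^bsub>M\<^esub> k)" if "r \<in> carrier R" "x \<in> N" for r x
    using that k D by (simp add: lin_simps)
qed

lemma project_self:
  assumes "k \<in> carrier M" "p k = \<one>"
  shows "project p k k = \<zero>\<^bsub>M\<^esub>"
  using assms by (simp add: project_def lin_simps)

lemma project_id:
  assumes "m \<in> carrier M" "k \<in> carrier M" "p m = \<zero>"
  shows "project p k m = m"
  using assms by (simp add: project_def)

lemma project_in_kernel: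
  assumes N: "submodule N R M" and p: "functional_on N p" and k: "k \<in> N" "p k = \<one>" and m: "m \<in> N"
  shows "project p k m \<in> kernel_on N p"
  using endo_onD(1)[OF endo_on_project[OF N p k(1)] m] k m
    functional_onD[OF p] submoduleD[OF N]
  by (simp add: kernel_on_def project_def R.r_neg)

lemma project_split:
  assumes "m \<in> carrier M" "k \<in> carrier M" "p m \<in> carrier R"
  shows "m = p m \<odot>\<^bsub>M\<^esub> k \<oplus>\<^bsub>M\<^esub> project p k m"
  using assms by (simp add: project_def lin_simps)

lemma functional_on_comp:
  assumes "functional_on N' f" "endo_on N g" "g ` N \<subseteq> N'"
  shows "functional_on N (f \<circ> g)"
proof -
  have "g x \<in> N'" if "x \<in> N" for x using assms(3) that by blast
  then show ?thesis
    using functional_onD[OF assms(1)] endo_onD[OF assms(2)]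
    by (auto simp: functional_on_def)
qed

lemma functional_on_combination:
  assumes "functional_on N f" "functional_on N g" "s \<in> carrier R" "t \<in> carrier R"
  shows "functional_on N (\<lambda>m. s \<otimes> f m \<oplus> t \<otimes> g m)"
  using functional_onD[OF assms(1)] functional_onD[OF assms(2)] assms(3,4)
  unfolding functional_on_def by (auto simp: lin_simps)

lemma endo_on_comp:
  assumes "endo_on N f" "endo_on N g"
  shows "endo_on N (f \<circ> g)"
  using endo_onD[OF assms(1)] endo_onD[OF assms(2)] by (auto simp: endo_on_def)

text \<open>Free of rank \<open>n\<close>, expressed by splitting off one coordinate at a time; this is invariant
  enough to make a change of basis unnecessary.\<close>

primrec flag_rank :: "nat \<Rightarrow> 'c set \<Rightarrow> bool" where
  "flag_rank 0 N \<longleftrightarrow> N = {\<zero>\<^bsub>M\<^esub>}"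
| "flag_rank (Suc n) N \<longleftrightarrow>
    (\<exists>r x. functional_on N r \<and> x \<in> N \<and> r x = \<one> \<and> flag_rank n (kernel_on N r))"

text \<open>Every non-zero vector is a scalar times a vector that splits off as a direct summand
  with a complement of rank one less. Write \<open>v\<close> as r(v) x + v' with v' in the kernel of
  \<open>r\<close>, and by induction v' = c y. Of the coefficients r(v) and c, the one dividing the
  other is the content of \<open>v\<close>.\<close>

lemma flag_rank_content:
  assumes "submodule N R M" "flag_rank n N" "v \<in> N" "v \<noteq> \<zero>\<^bsub>M\<^esub>"
  shows "\<exists>c\<in>carrier R. \<exists>x\<in>N. \<exists>r. functional_on N r \<and> r x = \<one> \<and> v = c \<odot>\<^bsub>M\<^esub> x \<and>
    flag_rank (n - 1) (kernel_on N r)"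
  using assms
proof (induction n arbitrary: N v)
  case 0
  then show ?case by simp
next
  case (Suc n)
  note N = Suc.prems(1)
  from Suc.prems(2) obtain r x where r: "functional_on N r" and x: "x \<in> N" "r x = \<one>"
    and fl: "flag_rank n (kernel_on N r)" by auto
  note D = submoduleD[OF N] functional_onD[OF r]
  define v' where "v' = project r x v"
  have v': "v' \<in> kernel_on N r"
    unfolding v'_def by (rule project_in_kernel[OF N r x Suc.prems(3)])
  then have v'N: "v' \<in> N" by (simp add: kernel_on_def)
  have vs: "v = r v \<odot>\<^bsub>M\<^esub> x \<oplus>\<^bsub>M\<^esub> v'"
    unfolding v'_def using Suc.prems(3) x D by (intro project_split) auto
  have K: "submodule (kernel_on N r) R M" by (rule submodule_kernel_on[OF N r])
  show ?case
  proof (cases "v' = \<zero>\<^bsub>M\<^esub>")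
    case True
    then have "v = r v \<odot>\<^bsub>M\<^esub> x" using vs x D Suc.prems(3) by (metis M.r_zero smult_closed)
    then show ?thesis using r x fl Suc.prems(3) D by (metis diff_Suc_1)
  next
    case False
    from Suc.IH[OF K fl v' False] obtain c y s where
      c: "c \<in> carrier R" and y: "y \<in> kernel_on N r" and s: "functional_on (kernel_on N r) s"
      and sy: "s y = \<one>" and v'c: "v' = c \<odot>\<^bsub>M\<^esub> y" and fl': "flag_rank (n - 1) (kernel_on (kernel_on N r) s)"
      by blast
    have yN: "y \<in> N" "r y = \<zero>" using y by (auto simp: kernel_on_def)
    have rv: "r v \<in> carrier R" by (rule functional_onD(1)[OF r Suc.prems(3)])
    from divides_total[OF rv c] show ?thesis
    proof
      assume "r v divides c"
      then obtain d where d: "d \<in> carrier R" "c = r v \<otimes> d" unfolding factor_def by blast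
      \<comment> \<open>The content is r(v). Changing \<open>x\<close> by a vector of the kernel of
        \<open>r\<close> keeps the value one, so \<open>r\<close> and its kernel stay as they
        are.\<close>
      let ?x = "x \<oplus>\<^bsub>M\<^esub> d \<odot>\<^bsub>M\<^esub> y"
      have "?x \<in> N" "r ?x = \<one>" using d x yN D by auto
      moreover have "v = r v \<odot>\<^bsub>M\<^esub> ?x"
        using vs unfolding v'c d(2) using rv d(1) x yN D by (simp add: lin_simps)
      ultimately show ?thesis using r fl rv by (metis diff_Suc_1)
    next
      assume "c divides r v"
      then obtain d where d: "d \<in> carrier R" "r v = c \<otimes> d" unfolding factor_def by blast
      let ?x = "d \<odot>\<^bsub>M\<^esub> x \<oplus>\<^bsub>M\<^esub> y"
      \<comment> \<open>The content is c, the coefficient of \<open>y\<close>. The coordinate to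
        split off is now that of \<open>y\<close>, extended to all of \<open>N\<close> by ignoring
        \<open>x\<close>.\<close>
      let ?r = "s \<circ> project r x"
      \<comment> \<open>Over a zero kernel v' would vanish. Hence the truncated \<open>n - 1\<close>
        is a true predecessor below.\<close>
      have n: "n \<noteq> 0" using fl v' False by (cases n) auto
      have fr: "functional_on N ?r"
        by (rule functional_on_comp[OF s endo_on_project[OF N r x(1)]])
          (use project_in_kernel[OF N r x] in auto)
      have xN: "?x \<in> N" using d x yN D by auto
      have "r ?x = d" using d(1) x yN D by simp
      then have "project r x ?x = y" unfolding project_def using d(1) x yN D
        by (simp add: lin_simps)
      then have rx: "?r ?x = \<one>" using sy by simp
      have vx: "v = c \<odot>\<^bsub>M\<^esub> ?x"
        using vs unfolding v'c d(2) using c d(1) x yN D by (simp add: lin_simps)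
      have s0: "s \<zero>\<^bsub>M\<^esub> = \<zero>" by (rule functional_on_zero[OF K s])
      have "x \<in> kernel_on N ?r"
        using x D s0 by (simp add: kernel_on_def project_self)
      moreover have "functional_on (kernel_on N ?r) r"
        by (rule functional_on_subset[OF r]) (auto simp: kernel_on_def)
      \<comment> \<open>The two coordinates are split off in the opposite order: on the kernel of
        \<open>r\<close> the projection is the identity, so both orders leave the same complement,
        and \<open>x\<close> with \<open>r\<close> supplies the other level of the flag.\<close>
      moreover have "kernel_on (kernel_on N ?r) r = kernel_on (kernel_on N r) s"
        using x(1) D(1) by (auto simp: kernel_on_def project_id)
      ultimately have "flag_rank (Suc (n - 1)) (kernel_on N ?r)"
        using x(2) fl' by (metis flag_rank.simps(2))
      then have "flag_rank (Suc n - 1) (kernel_on N ?r)" using n by simp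
      then show ?thesis using fr xN rx vx c by blast
    qed
  qed
qed

text \<open>Write v = d x with r(x) = 1. Applying \<open>r\<close> to c v = 0 gives c d = 0 in a
  domain.\<close>

lemma flag_rank_torsion_free:
  assumes "submodule N R M" "flag_rank n N" "v \<in> N" "c \<in> carrier R" "c \<odot>\<^bsub>M\<^esub> v = \<zero>\<^bsub>M\<^esub>"
  shows "c = \<zero> \<or> v = \<zero>\<^bsub>M\<^esub>"
proof (cases "v = \<zero>\<^bsub>M\<^esub>")
  case False
  then obtain d x r where d: "d \<in> carrier R" and x: "x \<in> N" and r: "functional_on N r" "r x = \<one>"
    and v: "v = d \<odot>\<^bsub>M\<^esub> x" using flag_rank_content[OF assms(1-3)] by blast
  have "r (c \<odot>\<^bsub>M\<^esub> v) = c \<otimes> d"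
    unfolding v using d x r(2) assms(4) submoduleD(3)[OF assms(1)] functional_onD[OF r(1)] by simp
  then have "c \<otimes> d = \<zero>" using assms(5) functional_on_zero[OF assms(1) r(1)] by simp
  then have "c = \<zero> \<or> d = \<zero>" using assms d integral by blast
  then show ?thesis using v x submoduleD[OF assms(1)] by auto
qed simp

section \<open>Factorisation of singular endomorphisms\<close>

text \<open>A kernel vector may be replaced by its primitive part: if v = c k, then c annihilates
  \<alpha> k, and torsion-freeness kills \<alpha> k.\<close>

lemma singular_kernel_vector:
  assumes N: "submodule N R M" and fl: "flag_rank n N" and \<alpha>: "endo_on N \<alpha>"
    and v: "v \<in> N" "v \<noteq> \<zero>\<^bsub>M\<^esub>" "\<alpha> v = \<zero>\<^bsub>M\<^esub>"
  shows "\<exists>k\<in>N. \<exists>f. functional_on N f \<and> f k = \<one> \<and> \<alpha> k = \<zero>\<^bsub>M\<^esub> \<and> flag_rank (n - 1) (kernel_on N f)"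
proof -
  from flag_rank_content[OF N fl v(1,2)] obtain c k f where
    c: "c \<in> carrier R" and k: "k \<in> N" and f: "functional_on N f" "f k = \<one>"
    and vc: "v = c \<odot>\<^bsub>M\<^esub> k" and fl': "flag_rank (n - 1) (kernel_on N f)" by blast
  have "c \<noteq> \<zero>" using vc v(2) k submoduleD(1)[OF N] by auto
  moreover have "c \<odot>\<^bsub>M\<^esub> \<alpha> k = \<zero>\<^bsub>M\<^esub>" using vc v(3) c k endo_onD(3)[OF \<alpha>] by simp
  ultimately have "\<alpha> k = \<zero>\<^bsub>M\<^esub>"
    using flag_rank_torsion_free[OF N fl endo_onD(1)[OF \<alpha> k] c] by blast
  then show ?thesis using k f fl' by blast
qed

text \<open>Seek p = s f + t r. With a = f(x) and b = r(k) the requirements are s + t b = 1 and s a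
  + t = 1, a system with determinant 1 - a b. This is a unit by locality, since a is not.\<close>

lemma common_dual_functional:
  assumes N: "submodule N R M" and f: "functional_on N f" and r: "functional_on N r"
    and k: "k \<in> N" "f k = \<one>" and x: "x \<in> N" "r x = \<one>" and nu: "f x \<notin> Units R"
  shows "\<exists>p. functional_on N p \<and> p k = \<one> \<and> p x = \<one>"
proof -
  define a where "a = f x"
  define b where "b = r k"
  define D where "D = \<one> \<oplus> \<ominus> (a \<otimes> b)"
  have ab: "a \<in> carrier R" "b \<in> carrier R"
    using functional_onD(1)[OF f x(1)] functional_onD(1)[OF r k(1)] by (auto simp: a_def b_def)
  have Du: "D \<in> Units R" using unit_or_one_minus_mult_unit[OF ab] nu by (simp add: a_def D_def)
  then have Dc: "D \<in> carrier R" "inv D \<in> carrier R" "inv D \<otimes> D = \<one>" by auto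
  \<comment> \<open>Cramer's rule for \<open>t\<close>. The first equation then gives
    \<open>s\<close>.\<close>
  define t where "t = (\<one> \<oplus> \<ominus> a) \<otimes> inv D"
  define s where "s = \<one> \<oplus> \<ominus> (t \<otimes> b)"
  have ts: "t \<in> carrier R" "s \<in> carrier R" using ab Dc by (auto simp: t_def s_def)
  have "t \<otimes> D = (\<one> \<oplus> \<ominus> a) \<otimes> (inv D \<otimes> D)"
    unfolding t_def using ab Dc(1,2) by (simp add: R.m_assoc)
  then have tD: "t \<otimes> D = \<one> \<oplus> \<ominus> a" using ab Dc(3) by simp
  let ?p = "\<lambda>m. s \<otimes> f m \<oplus> t \<otimes> r m"
  have "?p k = \<one>" using k(2) ab ts by (simp add: b_def[symmetric] s_def lin_simps)
  moreover have "?p x = a \<oplus> t \<otimes> D"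
    using x(2) ab ts by (simp add: a_def[symmetric] s_def D_def lin_simps)
  then have "?p x = \<one>" unfolding tD using ab by (simp add: lin_simps)
  ultimately show ?thesis using functional_on_combination[OF f r ts(2,1)] by blast
qed

text \<open>Supplies the vectors and functionals for one rank step. The vector \<open>x\<close> is
  the primitive part of the image of some \<open>z\<close> independent of the kernel vector
  \<open>k\<close>, and \<open>p\<close> has to take the value one on both \<open>k\<close> and
  \<open>x\<close>.\<close>

lemma singular_reduction_data:
  assumes N: "submodule N R M" and fl: "flag_rank (Suc n) N" and n: "n \<ge> 1" and \<alpha>: "endo_on N \<alpha>"
    and v: "v \<in> N" "v \<noteq> \<zero>\<^bsub>M\<^esub>" "\<alpha> v = \<zero>\<^bsub>M\<^esub>"
  obtains k x y c p r where "k \<in> N" "x \<in> N" "y \<in> N" "c \<in> carrier R"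
    "functional_on N p" "p k = \<one>" "p x = \<one>" "p y = \<zero>"
    "functional_on N r" "r x = \<one>" "flag_rank n (kernel_on N r)"
    "\<alpha> k = \<zero>\<^bsub>M\<^esub>" "y \<noteq> \<zero>\<^bsub>M\<^esub>" "\<alpha> y = c \<odot>\<^bsub>M\<^esub> x"
proof -
  from singular_kernel_vector[OF N fl \<alpha> v] obtain k f where
    k: "k \<in> N" and f: "functional_on N f" "f k = \<one>" and \<alpha>k: "\<alpha> k = \<zero>\<^bsub>M\<^esub>"
    and flf: "flag_rank n (kernel_on N f)" by auto
  have K: "submodule (kernel_on N f) R M" by (rule submodule_kernel_on[OF N f(1)])
  \<comment> \<open>As \<open>n\<close> is at least one, the complement of the line of
    \<open>k\<close> has a coordinate vector \<open>z\<close>.\<close>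
  from flf n obtain z g where z: "z \<in> kernel_on N f" and g: "functional_on (kernel_on N f) g" "g z = \<one>"
    by (cases n) auto
  have z0: "z \<noteq> \<zero>\<^bsub>M\<^esub>" using g functional_on_zero[OF K g(1)] by auto
  have zN: "z \<in> N" "f z = \<zero>" using z by (auto simp: kernel_on_def)
  have \<alpha>z: "\<alpha> z \<in> N" by (rule endo_onD(1)[OF \<alpha> zN(1)])
  have "\<exists>x\<in>N. \<exists>c\<in>carrier R. \<exists>r p. functional_on N r \<and> r x = \<one> \<and> flag_rank n (kernel_on N r) \<and>
     functional_on N p \<and> p k = \<one> \<and> p x = \<one> \<and> \<alpha> z = c \<odot>\<^bsub>M\<^esub> x"
  proof (cases "\<alpha> z = \<zero>\<^bsub>M\<^esub>")
    case True
    \<comment> \<open>With zero image there is no direction to follow. Taking x = k and c = 0 lets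
      \<open>f\<close> serve as both \<open>r\<close> and \<open>p\<close>.\<close>
    then have "\<alpha> z = \<zero> \<odot>\<^bsub>M\<^esub> k" using k submoduleD(1)[OF N] by simp
    then show ?thesis using k f flf by blast
  next
    case False
    from flag_rank_content[OF N fl \<alpha>z False] obtain c x r where
      c: "c \<in> carrier R" and x: "x \<in> N" and r: "functional_on N r" "r x = \<one>"
      and zc: "\<alpha> z = c \<odot>\<^bsub>M\<^esub> x" and flr: "flag_rank n (kernel_on N r)" by auto
    have xM: "x \<in> carrier M" using submoduleD(1)[OF N x] .
    show ?thesis
    proof (cases "f x \<in> Units R")
      case True
      define a where "a = f x"
      have a: "a \<in> carrier R" "inv a \<in> carrier R" "a \<otimes> inv a = \<one>" "inv a \<otimes> a = \<one>"
        using True by (auto simp: a_def)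
      \<comment> \<open>If f(x) is a unit, dividing \<open>x\<close> by it makes \<open>f\<close>
        itself the common functional. The scalar \<open>c\<close> and the functional
        \<open>r\<close> are multiplied by the same unit to compensate.\<close>
      define x' where "x' = inv a \<odot>\<^bsub>M\<^esub> x"
      \<comment> \<open>The zero summand presents a rescaled functional as an instance of
        \<open>functional_on_combination\<close>.\<close>
      define r' where "r' = (\<lambda>m. a \<otimes> r m \<oplus> \<zero> \<otimes> r m)"
      have xN: "x' \<in> N" unfolding x'_def using a x submoduleD(3)[OF N] by blast
      have fr: "functional_on N r'" unfolding r'_def using functional_on_combination[OF r(1) r(1)] a by blast
      have rx: "r' x' = \<one>" unfolding r'_def x'_def using r(2) a x functional_onD(3)[OF r(1)] by simp
      have fx: "f x' = \<one>" unfolding x'_def using a x functional_onD(3)[OF f(1)] by (simp add: a_def[symmetric])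
      have "a \<noteq> \<zero>" using a by auto
      then have "kernel_on N r' = kernel_on N r"
        using a functional_onD(1)[OF r(1)] by (auto simp: r'_def kernel_on_def integral_iff)
      then have flr': "flag_rank n (kernel_on N r')" using flr by simp
      have "(c \<otimes> a) \<odot>\<^bsub>M\<^esub> x' = (c \<otimes> (a \<otimes> inv a)) \<odot>\<^bsub>M\<^esub> x"
        unfolding x'_def using c a(1,2) xM by (simp add: smult_assoc1)
      then have "\<alpha> z = (c \<otimes> a) \<odot>\<^bsub>M\<^esub> x'" using zc c a(3) by simp
      moreover have "c \<otimes> a \<in> carrier R" using c a(1) by simp
      ultimately show ?thesis
        using xN fr rx fx flr' f by blast
    next
      case False
      from common_dual_functional[OF N f(1) r(1) k f(2) x r(2) False]
      show ?thesis using c x r zc flr by blast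
    qed
  qed
  then obtain x c r p where x: "x \<in> N" and c: "c \<in> carrier R" and r: "functional_on N r" "r x = \<one>"
    and flr: "flag_rank n (kernel_on N r)" and p: "functional_on N p" "p k = \<one>" "p x = \<one>"
    and zc: "\<alpha> z = c \<odot>\<^bsub>M\<^esub> x" by blast
  \<comment> \<open>Subtracting p(z) k brings \<open>z\<close> into the kernel of \<open>p\<close>
    without changing its image, because \<alpha> kills \<open>k\<close>.\<close>
  define y where "y = project p k z"
  have "y \<in> kernel_on N p" unfolding y_def by (rule project_in_kernel[OF N p(1) k p(2) zN(1)])
  then have y: "y \<in> N" "p y = \<zero>" by (auto simp: kernel_on_def)
  have pz: "p z \<in> carrier R" by (rule functional_onD(1)[OF p(1) zN(1)])
  have M: "k \<in> carrier M" "z \<in> carrier M" "x \<in> carrier M" using k zN x submoduleD(1)[OF N] by auto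
  \<comment> \<open>If \<open>y\<close> were zero, this would force p(z) = 0 and hence y = z, but
    \<open>z\<close> is non-zero.\<close>
  have "f y = \<ominus> p z"
    unfolding y_def project_def using pz zN k f(2) functional_onD[OF f(1)] submoduleD(3)[OF N] by simp
  moreover have "y = z" if "p z = \<zero>" unfolding y_def using that M by (simp add: project_id)
  ultimately have y0: "y \<noteq> \<zero>\<^bsub>M\<^esub>"
    using functional_on_zero[OF N f(1)] z0 pz by (metis R.minus_minus R.minus_zero)
  have "\<alpha> y = \<alpha> z"
    unfolding y_def project_def using pz zN k \<alpha>k endo_onD[OF \<alpha>] submoduleD(1,3)[OF N] by simp
  then show thesis using that k x y c p r flr \<alpha>k y0 zc by metis
qed

section \<open>Products of projections\<close>

definition split_pair :: "'c set \<Rightarrow> ('c \<Rightarrow> 'a) \<times> 'c \<Rightarrow> bool"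
  where "split_pair N = (\<lambda>(p, k). functional_on N p \<and> k \<in> N \<and> p k = \<one>)"

text \<open>The head of the list is the leftmost factor and acts last, which matches composition in
  the endomorphism ring.\<close>

definition project_list :: "(('c \<Rightarrow> 'a) \<times> 'c) list \<Rightarrow> 'c \<Rightarrow> 'c"
  where "project_list ps = foldr (\<lambda>(p, k). project p k) ps"

lemma project_list_simps [simp]:
  "project_list [] m = m"
  "project_list ((p, k) # ps) m = project p k (project_list ps m)"
  "project_list (ps @ qs) m = project_list ps (project_list qs m)"
  by (simp_all add: project_list_def)

lemma project_list_closed:
  assumes N: "submodule N R M" and "\<forall>pk\<in>set ps. split_pair N pk" "m \<in> N"
  shows "project_list ps m \<in> N"
  using assms(2)
proof (induction ps)
  case (Cons pk ps)
  obtain p k where "pk = (p, k)" by fastforce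
  then show ?case using Cons endo_onD(1)[OF endo_on_project[OF N]]
    by (auto simp: split_pair_def)
qed (use assms in simp)

text \<open>Lifts a product on the complement of the line of \<open>x\<close> to \<open>N\<close>,
  with the identity on that line. Each functional is pulled back along the projection that forgets
  the \<open>x\<close> component, and the vectors are kept.\<close>

lemma project_list_extend:
  assumes N: "submodule N R M" and r: "functional_on N r" and x: "x \<in> N" "r x = \<one>"
    and ps: "\<forall>pk\<in>set ps. split_pair (kernel_on N r) pk"
  defines "qs \<equiv> map (\<lambda>(p, k). (p \<circ> project r x, k)) ps"
  shows "\<forall>pk\<in>set qs. split_pair N pk"
    and "m \<in> N \<Longrightarrow> project_list qs m = r m \<odot>\<^bsub>M\<^esub> x \<oplus>\<^bsub>M\<^esub> project_list ps (project r x m)"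
proof -
  note D = submoduleD[OF N] functional_onD[OF r]
  have K: "submodule (kernel_on N r) R M" by (rule submodule_kernel_on[OF N r])
  have img: "project r x ` N \<subseteq> kernel_on N r" using project_in_kernel[OF N r x] by auto
  show "\<forall>pk\<in>set qs. split_pair N pk"
  proof
    fix pk assume "pk \<in> set qs"
    then obtain p k where pk: "pk = (p \<circ> project r x, k)" and "(p, k) \<in> set ps"
      unfolding qs_def by auto
    then have p: "functional_on (kernel_on N r) p" "k \<in> kernel_on N r" "p k = \<one>"
      using ps by (auto simp: split_pair_def)
    have k: "k \<in> N" "r k = \<zero>" using p(2) by (auto simp: kernel_on_def)
    have "functional_on N (p \<circ> project r x)"
      by (rule functional_on_comp[OF p(1) endo_on_project[OF N r x(1)] img])
    then show "split_pair N pk"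
      using k p(3) x(1) D(1) by (simp add: pk split_pair_def project_id)
  qed
  show "project_list qs m = r m \<odot>\<^bsub>M\<^esub> x \<oplus>\<^bsub>M\<^esub> project_list ps (project r x m)" if m: "m \<in> N"
    using ps unfolding qs_def
  proof (induction ps)
    case Nil
    show ?case using project_split[of m x r] m x(1) D by simp
  next
    case (Cons pk ps)
    obtain p k where pk: "pk = (p, k)" by fastforce
    define w where "w = project_list ps (project r x m)"
    have w: "w \<in> kernel_on N r"
      unfolding w_def using Cons.prems img m by (intro project_list_closed[OF K]) auto
    have p: "functional_on (kernel_on N r) p" "k \<in> kernel_on N r" "p k = \<one>"
      using Cons.prems pk by (auto simp: split_pair_def)
    have wN: "w \<in> N" "r w = \<zero>" "k \<in> N" using w p(2) by (auto simp: kernel_on_def)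
    have pw: "p w \<in> carrier R" by (rule functional_onD(1)[OF p(1) w])
    \<comment> \<open>The pulled-back functional does not see the \<open>x\<close> component, so the
      next factor changes only \<open>w\<close>.\<close>
    have "project r x (r m \<odot>\<^bsub>M\<^esub> x \<oplus>\<^bsub>M\<^esub> w) = w"
      unfolding project_def using wN x m D by (simp add: lin_simps)
    moreover have "project_list (map (\<lambda>(p, k). (p \<circ> project r x, k)) ps) m = r m \<odot>\<^bsub>M\<^esub> x \<oplus>\<^bsub>M\<^esub> w"
      unfolding w_def by (rule Cons.IH) (use Cons.prems in auto)
    ultimately show ?case
      using wN x(1) m pw D
      unfolding pk list.map prod.case project_list_simps w_def[symmetric]
      by (simp add: project_def[of "p \<circ> project r x"] project_def[of p] M.a_assoc)
  qed
qed

text \<open>In a basis \<open>k\<close>, \<open>l\<close> with \<alpha> k = 0 and \<alpha> l = b k +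
  d l, the map sends \<open>m\<close> to g(m) \<alpha> l. The first projection sends
  \<open>m\<close> to g(m) (w k + l), and the second subtracts g(m) times the vector w k + l -
  \<alpha> l. It remains to choose the parameters so that both are split pairs.\<close>

lemma singular_rank_two_product:
  assumes N: "submodule N R M" and fl: "flag_rank 2 N" and \<alpha>: "endo_on N \<alpha>"
    and v: "v \<in> N" "v \<noteq> \<zero>\<^bsub>M\<^esub>" "\<alpha> v = \<zero>\<^bsub>M\<^esub>"
  shows "\<exists>ps. length ps = 2 \<and> (\<forall>pk\<in>set ps. split_pair N pk) \<and> (\<forall>m\<in>N. \<alpha> m = project_list ps m)"
proof -
  from singular_kernel_vector[OF N fl \<alpha> v] obtain k f where
    k: "k \<in> N" and f: "functional_on N f" "f k = \<one>" and \<alpha>k: "\<alpha> k = \<zero>\<^bsub>M\<^esub>"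
    and flf: "flag_rank (Suc 0) (kernel_on N f)" by auto
  have K: "submodule (kernel_on N f) R M" by (rule submodule_kernel_on[OF N f(1)])
  from flf obtain l h where l: "l \<in> kernel_on N f" and h: "functional_on (kernel_on N f) h" "h l = \<one>"
    and h0: "kernel_on (kernel_on N f) h = {\<zero>\<^bsub>M\<^esub>}" by auto
  have lN: "l \<in> N" "f l = \<zero>" using l by (auto simp: kernel_on_def)
  have M: "k \<in> carrier M" "l \<in> carrier M" using k lN submoduleD(1)[OF N] by auto
  define g where "g = h \<circ> project f k"
  have img: "project f k ` N \<subseteq> kernel_on N f" using project_in_kernel[OF N f(1) k f(2)] by auto
  have g: "functional_on N g"
    unfolding g_def by (rule functional_on_comp[OF h(1) endo_on_project[OF N f(1) k] img])
  have gk: "g k = \<zero>" using M f(2) functional_on_zero[OF K h(1)] by (simp add: g_def project_self)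
  have gl: "g l = \<one>" using M lN h(2) by (simp add: g_def project_id)
  have co: "f m \<in> carrier R" "g m \<in> carrier R" if "m \<in> N" for m
    using that functional_onD(1)[OF f(1)] functional_onD(1)[OF g] by auto
  have dec: "m = f m \<odot>\<^bsub>M\<^esub> k \<oplus>\<^bsub>M\<^esub> g m \<odot>\<^bsub>M\<^esub> l" if m: "m \<in> N" for m
  proof -
    have w: "project f k m \<in> kernel_on N f" using img m by auto
    \<comment> \<open>The rank is two, so nothing is left once both coordinates are removed.\<close>
    have "project h l (project f k m) \<in> kernel_on (kernel_on N f) h"
      by (rule project_in_kernel[OF K h(1) l h(2) w])
    then have "project h l (project f k m) = \<zero>\<^bsub>M\<^esub>" using h0 by simp
    then have "project f k m = g m \<odot>\<^bsub>M\<^esub> l"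
      using project_split[of "project f k m" l h] submoduleD(1)[OF K w] M functional_onD(1)[OF h(1) w]
      by (simp add: g_def)
    then show ?thesis using project_split[of m k f] m M co submoduleD(1)[OF N] by simp
  qed
  define b where "b = f (\<alpha> l)"
  define d where "d = g (\<alpha> l)"
  have \<alpha>l: "\<alpha> l \<in> N" by (rule endo_onD(1)[OF \<alpha> lN(1)])
  have bd: "b \<in> carrier R" "d \<in> carrier R" using co[OF \<alpha>l] by (auto simp: b_def d_def)
  have \<alpha>l_eq: "\<alpha> l = b \<odot>\<^bsub>M\<^esub> k \<oplus>\<^bsub>M\<^esub> d \<odot>\<^bsub>M\<^esub> l" using dec[OF \<alpha>l] by (simp add: b_def d_def)
  have \<alpha>_eq: "\<alpha> m = g m \<odot>\<^bsub>M\<^esub> (b \<odot>\<^bsub>M\<^esub> k \<oplus>\<^bsub>M\<^esub> d \<odot>\<^bsub>M\<^esub> l)" if m: "m \<in> N" for m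
  proof -
    have "\<alpha> m = \<alpha> (f m \<odot>\<^bsub>M\<^esub> k \<oplus>\<^bsub>M\<^esub> g m \<odot>\<^bsub>M\<^esub> l)" using dec[OF m] by simp
    also have "\<dots> = f m \<odot>\<^bsub>M\<^esub> \<alpha> k \<oplus>\<^bsub>M\<^esub> g m \<odot>\<^bsub>M\<^esub> \<alpha> l"
      using co[OF m] k lN endo_onD[OF \<alpha>] submoduleD(3)[OF N] by simp
    finally show ?thesis using co[OF m] bd M by (simp add: \<alpha>k \<alpha>l_eq)
  qed
  \<comment> \<open>The two equations say that the functional s f + t g is one at w k + l - \<alpha>
    l and at w k + l. Together they force s b + t d = 0, that is, the functional vanishes on the
    image of \<alpha>.\<close>
  have P: "\<exists>ps. length ps = 2 \<and> (\<forall>pk\<in>set ps. split_pair N pk) \<and> (\<forall>m\<in>N. \<alpha> m = project_list ps m)"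
    if t: "s \<in> carrier R" "t \<in> carrier R" "w \<in> carrier R"
      and s: "s \<otimes> (w \<oplus> \<ominus> b) \<oplus> t \<otimes> (\<one> \<oplus> \<ominus> d) = \<one>" and u: "s \<otimes> w \<oplus> t = \<one>" for s t w
  proof -
    \<comment> \<open>This is w k + l - \<alpha> l, written in coordinates.\<close>
    define k1 where "k1 = (w \<oplus> \<ominus> b) \<odot>\<^bsub>M\<^esub> k \<oplus>\<^bsub>M\<^esub> (\<one> \<oplus> \<ominus> d) \<odot>\<^bsub>M\<^esub> l"
    define p1 where "p1 = (\<lambda>m. s \<otimes> f m \<oplus> t \<otimes> g m)"
    \<comment> \<open>One at \<open>k\<close> and zero at w k + l, so its projection along
      \<open>k\<close> has the line of w k + l as image.\<close>
    define p2 where "p2 = (\<lambda>m. \<one> \<otimes> f m \<oplus> (\<ominus> w) \<otimes> g m)"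
    have k1: "k1 \<in> N" unfolding k1_def using t bd k lN submoduleD(3,4)[OF N] by simp
    have p: "functional_on N p1" "functional_on N p2"
      unfolding p1_def p2_def using t by (auto intro!: functional_on_combination[OF f(1) g])
    have fg1: "f (a \<odot>\<^bsub>M\<^esub> k \<oplus>\<^bsub>M\<^esub> c \<odot>\<^bsub>M\<^esub> l) = a" "g (a \<odot>\<^bsub>M\<^esub> k \<oplus>\<^bsub>M\<^esub> c \<odot>\<^bsub>M\<^esub> l) = c"
      if "a \<in> carrier R" "c \<in> carrier R" for a c
      using that k lN f(2) gk gl functional_onD[OF f(1)] functional_onD[OF g] submoduleD(3)[OF N]
      by simp_all
    have 1: "split_pair N (p1, k1)"
      using p(1) k1 s t bd by (simp add: split_pair_def) (simp add: p1_def k1_def fg1)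
    have 2: "split_pair N (p2, k)"
      using p(2) k t by (simp add: split_pair_def) (simp add: p2_def f(2) gk)
    have "\<alpha> m = project p1 k1 (project p2 k m)" if m: "m \<in> N" for m
    proof -
      note c = co[OF m]
      have "project p2 k m = (f m \<odot>\<^bsub>M\<^esub> k \<oplus>\<^bsub>M\<^esub> g m \<odot>\<^bsub>M\<^esub> l) \<oplus>\<^bsub>M\<^esub> (\<ominus> p2 m) \<odot>\<^bsub>M\<^esub> k"
        using dec[OF m] by (simp add: project_def)
      also have "\<dots> = (w \<otimes> g m) \<odot>\<^bsub>M\<^esub> k \<oplus>\<^bsub>M\<^esub> g m \<odot>\<^bsub>M\<^esub> l"
        using c t M by (simp add: p2_def lin_simps)
      finally have e: "project p2 k m = (w \<otimes> g m) \<odot>\<^bsub>M\<^esub> k \<oplus>\<^bsub>M\<^esub> g m \<odot>\<^bsub>M\<^esub> l" .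
      have "p1 ((w \<otimes> g m) \<odot>\<^bsub>M\<^esub> k \<oplus>\<^bsub>M\<^esub> g m \<odot>\<^bsub>M\<^esub> l) = (s \<otimes> w \<oplus> t) \<otimes> g m"
        using c t by (simp add: p1_def fg1 R.l_distr R.m_assoc)
      then have e1: "p1 ((w \<otimes> g m) \<odot>\<^bsub>M\<^esub> k \<oplus>\<^bsub>M\<^esub> g m \<odot>\<^bsub>M\<^esub> l) = g m" using u c by simp
      have "project p1 k1 (project p2 k m)
        = (w \<otimes> g m) \<odot>\<^bsub>M\<^esub> k \<oplus>\<^bsub>M\<^esub> g m \<odot>\<^bsub>M\<^esub> l \<oplus>\<^bsub>M\<^esub> (\<ominus> g m) \<odot>\<^bsub>M\<^esub> k1"
        unfolding e by (simp add: project_def e1)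
      also have "\<dots> = g m \<odot>\<^bsub>M\<^esub> (b \<odot>\<^bsub>M\<^esub> k \<oplus>\<^bsub>M\<^esub> d \<odot>\<^bsub>M\<^esub> l)"
        unfolding k1_def using c t bd M by (simp add: lin_simps)
      finally show ?thesis using \<alpha>_eq[OF m] by simp
    qed
    then show ?thesis using 1 2 by (intro exI[of _ "[(p1, k1), (p2, k)]"]) simp
  qed
  from divides_total[OF bd] show ?thesis
  proof
    assume "b divides d"
    then obtain e where e: "e \<in> carrier R" "d = b \<otimes> e" unfolding factor_def by blast
    \<comment> \<open>The row (-e, 1) annihilates (b, b e), and with its second entry equal to one,
      w = 0 suffices.\<close>
    show ?thesis
      by (rule P[of "\<ominus> e" \<one> \<zero>]) (use e bd in \<open>simp_all add: lin_simps\<close>)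
  next
    assume "d divides b"
    then obtain e where e: "e \<in> carrier R" "b = d \<otimes> e" unfolding factor_def by blast
    \<comment> \<open>The row (1, -e) annihilates (d e, d). Now w - e = 1 determines
      \<open>w\<close>.\<close>
    show ?thesis
      by (rule P[of \<one> "\<ominus> e" "\<one> \<oplus> e"]) (use e bd in \<open>simp_all add: lin_simps\<close>)
  qed
qed

text \<open>Writing the rank as \<open>n + 2\<close> starts the induction at rank two and turns
  twice the rank minus two into \<open>2 * n + 2\<close>.\<close>

lemma singular_product:
  assumes "submodule N R M" "flag_rank (n + 2) N" "endo_on N \<alpha>"
    "v \<in> N" "v \<noteq> \<zero>\<^bsub>M\<^esub>" "\<alpha> v = \<zero>\<^bsub>M\<^esub>"
  shows "\<exists>ps. length ps = 2 * n + 2 \<and> (\<forall>pk\<in>set ps. split_pair N pk) \<and>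
    (\<forall>m\<in>N. \<alpha> m = project_list ps m)"
  using assms
proof (induction n arbitrary: N \<alpha> v)
  case 0
  from singular_rank_two_product[OF 0(1) _ 0(3-6)] 0(2) show ?case by (simp add: numeral_2_eq_2)
next
  case (Suc n)
  note N = Suc.prems(1) and \<alpha> = Suc.prems(3)
  have "flag_rank (Suc (n + 2)) N" using Suc.prems(2) by simp
  then obtain k x y c p r where kxy: "k \<in> N" "x \<in> N" "y \<in> N" and c: "c \<in> carrier R"
    and p: "functional_on N p" "p k = \<one>" "p x = \<one>" "p y = \<zero>"
    and r: "functional_on N r" "r x = \<one>" and fl: "flag_rank (n + 2) (kernel_on N r)"
    and \<alpha>k: "\<alpha> k = \<zero>\<^bsub>M\<^esub>" and y0: "y \<noteq> \<zero>\<^bsub>M\<^esub>" and \<alpha>y: "\<alpha> y = c \<odot>\<^bsub>M\<^esub> x"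
    by (rule singular_reduction_data[OF N _ _ \<alpha> Suc.prems(4-6)]) simp_all
  note D = submoduleD[OF N]
  have M: "k \<in> carrier M" "x \<in> carrier M" "y \<in> carrier M" using kxy D(1) by auto
  \<comment> \<open>The modified map that kills \<open>x\<close> and agrees with \<alpha> on the
    kernel of \<open>p\<close>, in particular at \<open>y\<close>.\<close>
  define \<beta> where "\<beta> = \<alpha> \<circ> project p x"
  have \<beta>: "endo_on N \<beta>"
    unfolding \<beta>_def by (rule endo_on_comp[OF \<alpha> endo_on_project[OF N p(1) kxy(2)]])
  have \<beta>x: "\<beta> x = \<zero>\<^bsub>M\<^esub>"
    using project_self[of x p, OF M(2) p(3)] endo_on_zero[OF N \<alpha>] by (simp add: \<beta>_def)
  have \<beta>y: "\<beta> y = c \<odot>\<^bsub>M\<^esub> x" using M p(4) \<alpha>y by (simp add: \<beta>_def project_id)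
  define \<pi> where "\<pi> = project r x"
  have \<pi>: "endo_on N \<pi>" unfolding \<pi>_def by (rule endo_on_project[OF N r(1) kxy(2)])
  have \<pi>K: "\<pi> m \<in> kernel_on N r" if "m \<in> N" for m
    unfolding \<pi>_def by (rule project_in_kernel[OF N r(1) kxy(2) r(2) that])
  have K: "submodule (kernel_on N r) R M" by (rule submodule_kernel_on[OF N r(1)])
  have KN: "m \<in> N" if "m \<in> kernel_on N r" for m using that by (simp add: kernel_on_def)
  have \<beta>\<pi>: "\<beta> (\<pi> m) = \<beta> m" if m: "m \<in> N" for m
  proof -
    have rm: "r m \<in> carrier R" by (rule functional_onD(1)[OF r(1) m])
    have "\<beta> (\<pi> m) = \<beta> m \<oplus>\<^bsub>M\<^esub> (\<ominus> r m) \<odot>\<^bsub>M\<^esub> \<beta> x"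
      unfolding \<pi>_def project_def using m rm kxy endo_onD[OF \<beta>] D(3) by simp
    then show ?thesis using rm \<beta>x D(1)[OF endo_onD(1)[OF \<beta> m]] by simp
  qed
  \<comment> \<open>This is the endomorphism induced modulo \<open>x\<close> on the complement
    \<open>kernel_on N r\<close>. The vector \<pi> y is shown to be a non-zero element of its
    kernel, so the induction hypothesis applies.\<close>
  have "endo_on (kernel_on N r) (\<pi> \<circ> \<beta>)"
    using endo_onD[OF \<pi>] endo_onD[OF \<beta>] \<pi>K KN by (auto simp: endo_on_def)
  moreover have "\<pi> y \<in> kernel_on N r" by (rule \<pi>K[OF kxy(3)])
  \<comment> \<open>Otherwise \<open>y\<close> is a multiple of \<open>x\<close>. As p(x) = 1 and
    p(y) = 0, the multiple would be zero.\<close>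
  moreover have "\<pi> y \<noteq> \<zero>\<^bsub>M\<^esub>"
  proof
    assume "\<pi> y = \<zero>\<^bsub>M\<^esub>"
    then have ry: "r y \<in> carrier R" "y = r y \<odot>\<^bsub>M\<^esub> x"
      using project_split[of y x r] functional_onD(1)[OF r(1) kxy(3)] M by (auto simp: \<pi>_def)
    then have "p y = r y" using functional_onD(3)[OF p(1) ry(1) kxy(2)] p(3) by simp
    then show False using p(4) ry y0 M(2) smult_l_null by metis
  qed
  moreover have "(\<pi> \<circ> \<beta>) (\<pi> y) = \<zero>\<^bsub>M\<^esub>"
  proof -
    have "(\<pi> \<circ> \<beta>) (\<pi> y) = \<pi> (c \<odot>\<^bsub>M\<^esub> x)" using \<beta>\<pi>[OF kxy(3)] \<beta>y by simp
    also have "\<dots> = c \<odot>\<^bsub>M\<^esub> \<pi> x" using endo_onD(3)[OF \<pi> c kxy(2)] .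
    also have "\<pi> x = \<zero>\<^bsub>M\<^esub>" unfolding \<pi>_def by (rule project_self[of x r, OF M(2) r(2)])
    finally show ?thesis using c by simp
  qed
  ultimately obtain ps where len: "length ps = 2 * n + 2"
    and ps: "\<forall>pk\<in>set ps. split_pair (kernel_on N r) pk"
    and psm: "\<And>m. m \<in> kernel_on N r \<Longrightarrow> \<pi> (\<beta> m) = project_list ps m"
    using Suc.IH[OF K fl] by (metis comp_apply)
  define qs where "qs = map (\<lambda>(p, k). (p \<circ> project r x, k)) ps"
  have qs: "\<forall>pk\<in>set qs. split_pair N pk"
    and qsm: "\<And>m. m \<in> N \<Longrightarrow> project_list qs m = r m \<odot>\<^bsub>M\<^esub> x \<oplus>\<^bsub>M\<^esub> project_list ps (\<pi> m)"
    using project_list_extend[OF N r(1) kxy(2) r(2) ps] by (auto simp: qs_def \<pi>_def)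
  \<comment> \<open>Subtracting q(m) x replaces the \<open>x\<close> coordinate of \<open>m\<close>
    by that of \<beta> m. The list \<open>qs\<close> keeps this coordinate and corrects the
    component in the complement.\<close>
  define q where "q = (\<lambda>m. \<one> \<otimes> r m \<oplus> (\<ominus> \<one>) \<otimes> (r \<circ> \<beta>) m)"
  have r\<beta>: "functional_on N (r \<circ> \<beta>)"
    by (rule functional_on_comp[OF r(1) \<beta>]) (use endo_onD(1)[OF \<beta>] in auto)
  have q: "functional_on N q"
    unfolding q_def by (rule functional_on_combination[OF r(1) r\<beta>]) auto
  have qx: "q x = \<one>" using r(2) \<beta>x functional_on_zero[OF N r(1)] by (simp add: q_def)
  have \<beta>_eq: "\<beta> m = project_list qs (project q x m)" if m: "m \<in> N" for m
  proof -
    have rm: "r m \<in> carrier R" "r (\<beta> m) \<in> carrier R"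
      using functional_onD(1)[OF r(1)] m endo_onD(1)[OF \<beta> m] by auto
    have \<beta>m: "\<beta> m \<in> N" by (rule endo_onD(1)[OF \<beta> m])
    define m' where "m' = project q x m"
    have m'N: "m' \<in> N" unfolding m'_def by (rule endo_onD(1)[OF endo_on_project[OF N q kxy(2)] m])
    have m': "m' = m \<oplus>\<^bsub>M\<^esub> (r (\<beta> m) \<oplus> \<ominus> r m) \<odot>\<^bsub>M\<^esub> x"
      unfolding m'_def project_def q_def using rm by (simp add: lin_simps)
    have rm': "r m' = r (\<beta> m)"
      unfolding m' using rm m kxy(2) r(2) functional_onD[OF r(1)] D(3) by (simp add: lin_simps)
    have "\<beta> m' = \<beta> m"
      unfolding m' using rm m kxy(2) \<beta>x endo_onD[OF \<beta>] D(1,3) by simp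
    moreover have "project_list ps (\<pi> m') = \<pi> (\<beta> m')"
      using psm[OF \<pi>K[OF m'N]] \<beta>\<pi>[OF m'N] by simp
    ultimately have "project_list qs m' = r (\<beta> m) \<odot>\<^bsub>M\<^esub> x \<oplus>\<^bsub>M\<^esub> \<pi> (\<beta> m)"
      using qsm[OF m'N] rm' by simp
    also have "\<dots> = \<beta> m"
      using project_split[of "\<beta> m" x r] D(1)[OF \<beta>m] M rm by (simp add: \<pi>_def)
    finally show ?thesis by (simp add: m'_def)
  qed
  \<comment> \<open>After projecting along \<open>k\<close> the value of \<open>p\<close> is zero,
    so \<beta> agrees with \<alpha> there. The removed multiple of \<open>k\<close> is killed by
    \<alpha>.\<close>
  have \<alpha>_eq: "\<alpha> m = \<beta> (project p k m)" if m: "m \<in> N" for m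
  proof -
    have pm: "p m \<in> carrier R" by (rule functional_onD(1)[OF p(1) m])
    have e: "project p k m \<in> kernel_on N p" by (rule project_in_kernel[OF N p(1) kxy(1) p(2) m])
    then have "\<beta> (project p k m) = \<alpha> (project p k m)"
      using M D(1) by (simp add: \<beta>_def kernel_on_def project_id)
    also have "\<dots> = \<alpha> m"
      unfolding project_def using pm m kxy(1) \<alpha>k endo_onD[OF \<alpha>] D(1,3) by simp
    finally show ?thesis by simp
  qed
  let ?ps = "qs @ [(q, x), (p, k)]"
  have "length ?ps = 2 * Suc n + 2" using len by (simp add: qs_def)
  moreover have "\<forall>pk\<in>set ?ps. split_pair N pk"
    using qs q qx p kxy by (auto simp: split_pair_def)
  moreover have "\<forall>m\<in>N. \<alpha> m = project_list ?ps m"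
    using \<alpha>_eq \<beta>_eq endo_onD(1)[OF endo_on_project[OF N p(1) kxy(1)]] by simp
  ultimately show ?case by blast
qed

section \<open>Flags from bases\<close>

definition adjoin :: "'c \<Rightarrow> 'c set \<Rightarrow> 'c set"
  where "adjoin b N = {c \<odot>\<^bsub>M\<^esub> b \<oplus>\<^bsub>M\<^esub> s | c s. c \<in> carrier R \<and> s \<in> N}"

lemma submodule_adjoin:
  assumes N: "submodule N R M" and b: "b \<in> carrier M"
  shows "submodule (adjoin b N) R M"
proof (rule submoduleI)
  note D = submoduleD[OF N]
  have I: "z \<in> adjoin b N" if "z = c \<odot>\<^bsub>M\<^esub> b \<oplus>\<^bsub>M\<^esub> s" "c \<in> carrier R" "s \<in> N" for z c s
    using that by (auto simp: adjoin_def)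
  show "adjoin b N \<subseteq> carrier M" using b D by (auto simp: adjoin_def)
  show "\<zero>\<^bsub>M\<^esub> \<in> adjoin b N" by (rule I[of _ \<zero> "\<zero>\<^bsub>M\<^esub>"]) (use b D in auto)
  show "\<ominus>\<^bsub>M\<^esub> x \<in> adjoin b N" if x: "x \<in> adjoin b N" for x
  proof -
    from x obtain c s where "c \<in> carrier R" "s \<in> N" "x = c \<odot>\<^bsub>M\<^esub> b \<oplus>\<^bsub>M\<^esub> s" by (auto simp: adjoin_def)
    then show ?thesis using b D by (intro I[of _ "\<ominus> c" "\<ominus>\<^bsub>M\<^esub> s"]) (auto simp: lin_simps)
  qed
  show "x \<oplus>\<^bsub>M\<^esub> y \<in> adjoin b N" if xy: "x \<in> adjoin b N" "y \<in> adjoin b N" for x y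
  proof -
    from xy obtain c s d t where "c \<in> carrier R" "s \<in> N" "x = c \<odot>\<^bsub>M\<^esub> b \<oplus>\<^bsub>M\<^esub> s"
      "d \<in> carrier R" "t \<in> N" "y = d \<odot>\<^bsub>M\<^esub> b \<oplus>\<^bsub>M\<^esub> t" by (auto simp: adjoin_def)
    then show ?thesis using b D by (intro I[of _ "c \<oplus> d" "s \<oplus>\<^bsub>M\<^esub> t"]) (auto simp: lin_simps)
  qed
  show "a \<odot>\<^bsub>M\<^esub> x \<in> adjoin b N" if x: "a \<in> carrier R" "x \<in> adjoin b N" for a x
  proof -
    from x obtain c s where "c \<in> carrier R" "s \<in> N" "x = c \<odot>\<^bsub>M\<^esub> b \<oplus>\<^bsub>M\<^esub> s" by (auto simp: adjoin_def)
    then show ?thesis using b D x by (intro I[of _ "a \<otimes> c" "a \<odot>\<^bsub>M\<^esub> s"]) (auto simp: lin_simps)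
  qed
qed

text \<open>Independence makes the coefficient of \<open>b\<close> well defined. It is a functional
  with value one at \<open>b\<close> and kernel \<open>N\<close>, which is exactly one more level of
  the flag.\<close>

lemma flag_rank_adjoin:
  assumes N: "submodule N R M" and fl: "flag_rank n N" and b: "b \<in> carrier M"
    and indep: "\<And>c. c \<in> carrier R \<Longrightarrow> c \<odot>\<^bsub>M\<^esub> b \<in> N \<Longrightarrow> c = \<zero>"
  shows "flag_rank (Suc n) (adjoin b N)"
proof -
  note D = submoduleD[OF N]
  have uniq: "c = d" if "c \<in> carrier R" "d \<in> carrier R" "s \<in> N" "t \<in> N"
    "c \<odot>\<^bsub>M\<^esub> b \<oplus>\<^bsub>M\<^esub> s = d \<odot>\<^bsub>M\<^esub> b \<oplus>\<^bsub>M\<^esub> t" for c d s t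
  proof -
    \<comment> \<open>Subtracting the two representations puts a multiple of \<open>b\<close> into
      \<open>N\<close>, so its coefficient vanishes.\<close>
    have "(c \<oplus> \<ominus> d) \<odot>\<^bsub>M\<^esub> b = (c \<odot>\<^bsub>M\<^esub> b \<oplus>\<^bsub>M\<^esub> s) \<oplus>\<^bsub>M\<^esub> \<ominus>\<^bsub>M\<^esub> (d \<odot>\<^bsub>M\<^esub> b) \<oplus>\<^bsub>M\<^esub> \<ominus>\<^bsub>M\<^esub> s"
      using that(1-4) b D(1) by (simp add: lin_simps)
    also have "\<dots> = t \<oplus>\<^bsub>M\<^esub> \<ominus>\<^bsub>M\<^esub> s"
      unfolding that(5) using that(1-4) b D(1) by (simp add: lin_simps)
    finally have "c \<oplus> \<ominus> d = \<zero>" using that D by (intro indep) auto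
    then show ?thesis using that R.minus_equality R.minus_minus by (metis R.a_inv_closed R.add.m_comm)
  qed
  define r where "r z = (THE c. c \<in> carrier R \<and> (\<exists>s\<in>N. z = c \<odot>\<^bsub>M\<^esub> b \<oplus>\<^bsub>M\<^esub> s))" for z
  have r_eq: "r (c \<odot>\<^bsub>M\<^esub> b \<oplus>\<^bsub>M\<^esub> s) = c" if "c \<in> carrier R" "s \<in> N" for c s
    unfolding r_def by (rule the_equality) (use that uniq in blast)+
  have r: "functional_on (adjoin b N) r"
  proof (rule functional_onI)
    fix x assume "x \<in> adjoin b N"
    then obtain c s where x: "c \<in> carrier R" "s \<in> N" "x = c \<odot>\<^bsub>M\<^esub> b \<oplus>\<^bsub>M\<^esub> s" by (auto simp: adjoin_def)
    then show "r x \<in> carrier R" using r_eq by simp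
    show "r (a \<odot>\<^bsub>M\<^esub> x) = a \<otimes> r x" if a: "a \<in> carrier R" for a
    proof -
      have "a \<odot>\<^bsub>M\<^esub> x = (a \<otimes> c) \<odot>\<^bsub>M\<^esub> b \<oplus>\<^bsub>M\<^esub> a \<odot>\<^bsub>M\<^esub> s" using x a b D(1) by (simp add: lin_simps)
      then show ?thesis using x a r_eq D(3) by simp
    qed
    fix y assume "y \<in> adjoin b N"
    then obtain d t where y: "d \<in> carrier R" "t \<in> N" "y = d \<odot>\<^bsub>M\<^esub> b \<oplus>\<^bsub>M\<^esub> t" by (auto simp: adjoin_def)
    have "x \<oplus>\<^bsub>M\<^esub> y = (c \<oplus> d) \<odot>\<^bsub>M\<^esub> b \<oplus>\<^bsub>M\<^esub> (s \<oplus>\<^bsub>M\<^esub> t)" using x y b D(1) by (simp add: lin_simps)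
    then show "r (x \<oplus>\<^bsub>M\<^esub> y) = r x \<oplus> r y" using x y r_eq D(4) by simp
  qed
  have b_eq: "b = \<one> \<odot>\<^bsub>M\<^esub> b \<oplus>\<^bsub>M\<^esub> \<zero>\<^bsub>M\<^esub>" using b by simp
  then have "b \<in> adjoin b N" using D(2) unfolding adjoin_def by blast
  moreover have "r b = \<one>" using r_eq[of \<one> "\<zero>\<^bsub>M\<^esub>"] b_eq D(2) by simp
  moreover have "kernel_on (adjoin b N) r = N"
  proof
    show "kernel_on (adjoin b N) r \<subseteq> N"
      using r_eq b D(1) by (auto simp: kernel_on_def adjoin_def)
    show "N \<subseteq> kernel_on (adjoin b N) r"
    proof
      fix s assume s: "s \<in> N"
      then have "s = \<zero> \<odot>\<^bsub>M\<^esub> b \<oplus>\<^bsub>M\<^esub> s" using b D(1) by simp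
      then show "s \<in> kernel_on (adjoin b N) r"
        unfolding kernel_on_def adjoin_def using s r_eq[of \<zero> s] by fastforce
    qed
  qed
  ultimately show ?thesis using r fl by (metis flag_rank.simps(2))
qed

definition combinations :: "'c set \<Rightarrow> 'c set"
  where "combinations B = (\<lambda>a. \<Oplus>\<^bsub>M\<^esub>b\<in>B. a b \<odot>\<^bsub>M\<^esub> b) ` (B \<rightarrow> carrier R)"

lemma combinations_insert:
  assumes "finite B" "b \<notin> B" "insert b B \<subseteq> carrier M"
  shows "combinations (insert b B) = adjoin b (combinations B)"
proof
  have closed: "(\<lambda>x. a x \<odot>\<^bsub>M\<^esub> x) \<in> B \<rightarrow> carrier M" if "a \<in> B \<rightarrow> carrier R" for a
    using that assms(3) by auto
  show "combinations (insert b B) \<subseteq> adjoin b (combinations B)"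
  proof
    fix z assume "z \<in> combinations (insert b B)"
    then obtain a where a: "a \<in> insert b B \<rightarrow> carrier R" "z = (\<Oplus>\<^bsub>M\<^esub>x\<in>insert b B. a x \<odot>\<^bsub>M\<^esub> x)"
      by (auto simp: combinations_def)
    then have "z = a b \<odot>\<^bsub>M\<^esub> b \<oplus>\<^bsub>M\<^esub> (\<Oplus>\<^bsub>M\<^esub>x\<in>B. a x \<odot>\<^bsub>M\<^esub> x)"
      using assms closed by (subst a(2), subst M.finsum_insert) auto
    then show "z \<in> adjoin b (combinations B)"
      unfolding adjoin_def combinations_def using a(1) by blast
  qed
  show "adjoin b (combinations B) \<subseteq> combinations (insert b B)"
  proof
    fix z assume "z \<in> adjoin b (combinations B)"
    then obtain c a where a: "c \<in> carrier R" "a \<in> B \<rightarrow> carrier R"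
      "z = c \<odot>\<^bsub>M\<^esub> b \<oplus>\<^bsub>M\<^esub> (\<Oplus>\<^bsub>M\<^esub>x\<in>B. a x \<odot>\<^bsub>M\<^esub> x)"
      by (auto simp: combinations_def adjoin_def)
    define a' where "a' = a(b := c)"
    have a': "a' \<in> insert b B \<rightarrow> carrier R" using a by (auto simp: a'_def)
    have "(\<Oplus>\<^bsub>M\<^esub>x\<in>B. a' x \<odot>\<^bsub>M\<^esub> x) = (\<Oplus>\<^bsub>M\<^esub>x\<in>B. a x \<odot>\<^bsub>M\<^esub> x)"
      by (rule M.finsum_cong') (use assms a closed in \<open>auto simp: a'_def\<close>)
    then have "z = (\<Oplus>\<^bsub>M\<^esub>x\<in>insert b B. a' x \<odot>\<^bsub>M\<^esub> x)"
      using assms a closed[of a'] a' by (subst M.finsum_insert) (auto simp: a'_def)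
    then show "z \<in> combinations (insert b B)" unfolding combinations_def using a' by blast
  qed
qed

text \<open>Induction over the basis: each new vector is independent of the span of the earlier ones
  and adds one level to the flag.\<close>

lemma flag_rank_combinations:
  assumes "finite B" "B \<subseteq> carrier M"
    and "\<forall>a \<in> B \<rightarrow> carrier R. (\<Oplus>\<^bsub>M\<^esub>b\<in>B. a b \<odot>\<^bsub>M\<^esub> b) = \<zero>\<^bsub>M\<^esub> \<longrightarrow> (\<forall>b\<in>B. a b = \<zero>)"
  shows "submodule (combinations B) R M \<and> flag_rank (card B) (combinations B)"
  using assms
proof (induction B rule: finite_induct)
  case empty
  have "submodule {\<zero>\<^bsub>M\<^esub>} R M" by (rule submoduleI) auto
  moreover have "combinations {} = {\<zero>\<^bsub>M\<^esub>}" by (auto simp: combinations_def)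
  ultimately show ?case by simp
next
  case (insert b B)
  have b: "b \<in> carrier M" "B \<subseteq> carrier M" using insert.prems(1) by auto
  have sum_insert: "(\<Oplus>\<^bsub>M\<^esub>x\<in>insert b B. (a(b := c)) x \<odot>\<^bsub>M\<^esub> x) = c \<odot>\<^bsub>M\<^esub> b \<oplus>\<^bsub>M\<^esub> (\<Oplus>\<^bsub>M\<^esub>x\<in>B. a x \<odot>\<^bsub>M\<^esub> x)"
    if a: "a \<in> B \<rightarrow> carrier R" and c: "c \<in> carrier R" for a c
  proof -
    have "(\<Oplus>\<^bsub>M\<^esub>x\<in>B. (a(b := c)) x \<odot>\<^bsub>M\<^esub> x) = (\<Oplus>\<^bsub>M\<^esub>x\<in>B. a x \<odot>\<^bsub>M\<^esub> x)"
      by (rule M.finsum_cong') (use insert.hyps a b in auto)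
    then show ?thesis
      using insert.hyps a c b by (subst M.finsum_insert) (auto intro!: smult_closed)
  qed
  \<comment> \<open>Independence of the enlarged set, with the coefficient of \<open>b\<close>
    listed separately. Taking it zero restricts independence to \<open>B\<close>; taking it
    arbitrary shows that no non-zero multiple of \<open>b\<close> lies in the span of
    \<open>B\<close>.\<close>
  have ind: "\<forall>x\<in>insert b B. (a(b := c)) x = \<zero>"
    if "a \<in> B \<rightarrow> carrier R" "c \<in> carrier R"
      "c \<odot>\<^bsub>M\<^esub> b \<oplus>\<^bsub>M\<^esub> (\<Oplus>\<^bsub>M\<^esub>x\<in>B. a x \<odot>\<^bsub>M\<^esub> x) = \<zero>\<^bsub>M\<^esub>" for a c
  proof -
    have "a(b := c) \<in> insert b B \<rightarrow> carrier R" using that by auto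
    then have "(\<Oplus>\<^bsub>M\<^esub>x\<in>insert b B. (a(b := c)) x \<odot>\<^bsub>M\<^esub> x) = \<zero>\<^bsub>M\<^esub> \<longrightarrow>
      (\<forall>x\<in>insert b B. (a(b := c)) x = \<zero>)"
      by (rule bspec[OF insert.prems(2)])
    then show ?thesis by (rule mp) (simp only: sum_insert[OF that(1,2)] that(3))
  qed
  have "\<forall>a \<in> B \<rightarrow> carrier R. (\<Oplus>\<^bsub>M\<^esub>b\<in>B. a b \<odot>\<^bsub>M\<^esub> b) = \<zero>\<^bsub>M\<^esub> \<longrightarrow> (\<forall>b\<in>B. a b = \<zero>)"
  proof (intro ballI impI)
    fix a x assume a: "a \<in> B \<rightarrow> carrier R" "(\<Oplus>\<^bsub>M\<^esub>b\<in>B. a b \<odot>\<^bsub>M\<^esub> b) = \<zero>\<^bsub>M\<^esub>" and x: "x \<in> B"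
    then have "(a(b := \<zero>)) x = \<zero>" using b ind[OF a(1), of \<zero>] by simp
    then show "a x = \<zero>" using x insert.hyps by (auto split: if_splits)
  qed
  then have IH: "submodule (combinations B) R M" "flag_rank (card B) (combinations B)"
    using insert.IH b by auto
  have "c = \<zero>" if c: "c \<in> carrier R" "c \<odot>\<^bsub>M\<^esub> b \<in> combinations B" for c
  proof -
    \<comment> \<open>Expanding the negative of c b yields a vanishing combination whose coefficient
      at \<open>b\<close> is \<open>c\<close>.\<close>
    obtain a where a: "a \<in> B \<rightarrow> carrier R" "(\<ominus> c) \<odot>\<^bsub>M\<^esub> b = (\<Oplus>\<^bsub>M\<^esub>x\<in>B. a x \<odot>\<^bsub>M\<^esub> x)"
      using submoduleD(5)[OF IH(1) c(2)] smult_l_minus[OF c(1) b(1)]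
      by (auto simp: combinations_def)
    then show ?thesis using ind[OF a(1) c(1)] b c(1) a(2)[symmetric] by (simp add: lin_simps)
  qed
  then have "flag_rank (Suc (card B)) (adjoin b (combinations B))"
    by (intro flag_rank_adjoin IH b)
  then show ?case
    using combinations_insert[OF insert.hyps insert.prems(1)] submodule_adjoin[OF IH(1) b(1)] insert.hyps
    by simp
qed

lemma flag_rank_carrier:
  assumes "free_of_rank R M n"
  shows "flag_rank n (carrier M)"
proof -
  from assms obtain B where B: "finite_basis R M B" "card B = n" by (auto simp: free_of_rank_def)
  then have fl: "submodule (combinations B) R M \<and> flag_rank (card B) (combinations B)"
    by (intro flag_rank_combinations) (auto simp: finite_basis_def)
  have "carrier M \<subseteq> combinations B" using B(1) by (auto simp: finite_basis_def combinations_def)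
  then have "combinations B = carrier M" using fl submoduleD(1) by blast
  then show ?thesis using fl B(2) by simp
qed

end

section \<open>Coprimitive idempotents\<close>

lemma (in ring) right_ideal_right_annihilator:
  assumes e: "e \<in> carrier R"
  shows "right_ideal (right_annihilator R e) R"
  unfolding right_ideal_def
proof
  have "subgroup (right_annihilator R e) (add_monoid R)"
  proof (rule add.subgroupI)
    show "right_annihilator R e \<noteq> {}" using e by (auto simp: right_annihilator_def)
  qed (use e in \<open>auto simp: right_annihilator_def r_distr r_minus\<close>)
  then show "additive_subgroup (right_annihilator R e) R" by (rule additive_subgroupI)
  show "\<forall>x\<in>right_annihilator R e. \<forall>r\<in>carrier R. x \<otimes> r \<in> right_annihilator R e"
    using e by (auto simp: right_annihilator_def m_assoc[symmetric])
qed

context valuation_domain_module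
begin

section \<open>Projections as coprimitive elements of the endomorphism ring\<close>

lemma module_endos_iff:
  "f \<in> module_endos R M \<longleftrightarrow> endo_on (carrier M) f \<and> f \<in> extensional (carrier M)"
  by (auto simp: module_endos_def endo_on_def PiE_def)

lemma endo_on_restrict:
  assumes "endo_on (carrier M) f"
  shows "restrict f (carrier M) \<in> module_endos R M"
  using assms by (auto simp: module_endos_iff endo_on_def)

lemma endo_on_rank_one:
  assumes "functional_on (carrier M) f" "x \<in> carrier M"
  shows "endo_on (carrier M) (\<lambda>m. f m \<odot>\<^bsub>M\<^esub> x)"
  using functional_onD[OF assms(1)] assms(2) by (auto simp: endo_on_def lin_simps)

lemma coprimitive_project:
  assumes "split_pair (carrier M) (p, k)"
  shows "coprimitive_idempotent (End_ring R M) (restrict (project p k) (carrier M))"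
proof -
  let ?S = "End_ring R M" and ?C = "carrier M"
  let ?e = "restrict (project p k) ?C"
  let ?A = "right_annihilator ?S ?e"
  interpret S: ring ?S by (rule End_ring_is_ring)
  note N = carrier_is_submodule
  have p: "functional_on ?C p" "p k = \<one>" and k: "k \<in> ?C" using assms by (auto simp: split_pair_def)
  note pD = functional_onD[OF p(1)]
  have e: "?e \<in> carrier ?S"
    using endo_on_restrict[OF endo_on_project[OF N p(1) k]] by (simp add: End_ring_def)
  have pk: "project p k m \<in> ?C" "p (project p k m) = \<zero>" if "m \<in> ?C" for m
    using project_in_kernel[OF N p(1) k p(2) that] by (auto simp: kernel_on_def)
  have "?e \<otimes>\<^bsub>?S\<^esub> ?e = ?e"
    using pk k by (auto simp: End_ring_def compose_def project_id intro!: restrict_ext)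
  moreover have "right_ideal ?A ?S" by (rule S.right_ideal_right_annihilator[OF e])
  moreover have mem: "j x = p (j x) \<odot>\<^bsub>M\<^esub> k" "j x \<in> ?C" if j: "j \<in> ?A" and x: "x \<in> ?C" for j x
  proof -
    have jS: "j \<in> module_endos R M" and j0: "compose ?C ?e j = (\<lambda>x\<in>?C. \<zero>\<^bsub>M\<^esub>)"
      using j by (auto simp: right_annihilator_def End_ring_def)
    show jx: "j x \<in> ?C" using jS x by (auto simp: module_endos_def)
    have "project p k (j x) = \<zero>\<^bsub>M\<^esub>"
      using fun_cong[OF j0, of x] x jx by (simp add: compose_def)
    then show "j x = p (j x) \<odot>\<^bsub>M\<^esub> k"
      using project_split[of "j x" k p] jx k pD(1)[OF jx] by simp
  qed
  \<comment> \<open>Rank-one maps into the line of \<open>k\<close>, indexed injectively by scalars.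
    Every non-zero right ideal inside the annihilator will be shown to contain a non-zero
    one.\<close>
  define T where "T a = (\<lambda>m\<in>?C. p m \<odot>\<^bsub>M\<^esub> (a \<odot>\<^bsub>M\<^esub> k))" for a
  have TS: "T a \<in> carrier ?S" if "a \<in> carrier R" for a
    unfolding T_def using endo_on_restrict[OF endo_on_rank_one[OF p(1), of "a \<odot>\<^bsub>M\<^esub> k"]] that k
    by (simp add: End_ring_def)
  have T0: "a = \<zero>" if a: "a \<in> carrier R" "T a = \<zero>\<^bsub>?S\<^esub>" for a
  proof -
    have "T a k = \<zero>\<^bsub>M\<^esub>" using a(2) k by (simp add: End_ring_def)
    then have "a \<odot>\<^bsub>M\<^esub> k = \<zero>\<^bsub>M\<^esub>" using k a(1) p(2) by (simp add: T_def)
    moreover have "p (a \<odot>\<^bsub>M\<^esub> k) = a" using pD(3)[OF a(1) k] p(2) a(1) by simp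
    ultimately show ?thesis using functional_on_zero[OF N p(1)] by simp
  qed
  have T_mem: "\<exists>a\<in>carrier R. a \<noteq> \<zero> \<and> T a \<in> J"
    if J: "right_ideal J ?S" "J \<noteq> {\<zero>\<^bsub>?S\<^esub>}" "J \<subseteq> ?A" for J
  proof -
    interpret J: additive_subgroup J ?S using J(1) by (simp add: right_ideal_def)
    obtain j where j: "j \<in> J" "j \<noteq> \<zero>\<^bsub>?S\<^esub>" using J(2) J.zero_closed by blast
    have jA: "j \<in> ?A" using j J(3) by blast
    then have "j \<in> extensional ?C"
      by (auto simp: right_annihilator_def End_ring_def module_endos_iff)
    then obtain x where x: "x \<in> ?C" "j x \<noteq> \<zero>\<^bsub>M\<^esub>"
      using j(2) by (auto simp: End_ring_def extensional_def fun_eq_iff split: if_splits)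
    define a where "a = p (j x)"
    have jx: "j x = a \<odot>\<^bsub>M\<^esub> k" "j x \<in> ?C" using mem[OF jA x(1)] unfolding a_def by blast+
    have a: "a \<in> carrier R" unfolding a_def by (rule pD(1)[OF jx(2)])
    have a0: "a \<noteq> \<zero>" using jx(1) x(2) smult_l_null[OF k] by metis
    \<comment> \<open>Right multiplication by this map feeds the single vector \<open>x\<close> to
      \<open>j\<close>, and j(x) = a k turns the product into \<open>T a\<close>.\<close>
    let ?u = "\<lambda>m\<in>?C. p m \<odot>\<^bsub>M\<^esub> x"
    have u: "?u \<in> carrier ?S"
      using endo_on_restrict[OF endo_on_rank_one[OF p(1) x(1)]] by (simp add: End_ring_def)
    have "j \<otimes>\<^bsub>?S\<^esub> ?u \<in> J" using J(1) j(1) u by (simp add: right_ideal_def)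
    moreover have "j \<otimes>\<^bsub>?S\<^esub> ?u = T a"
    proof -
      have "endo_on ?C j" using jA by (auto simp: right_annihilator_def End_ring_def module_endos_iff)
      then have "j (p m \<odot>\<^bsub>M\<^esub> x) = p m \<odot>\<^bsub>M\<^esub> (a \<odot>\<^bsub>M\<^esub> k)" if "m \<in> ?C" for m
        using endo_onD(3)[of ?C j "p m" x] pD(1)[OF that] x(1) jx(1) by simp
      then show ?thesis by (auto simp: End_ring_def compose_def T_def intro!: restrict_ext)
    qed
    ultimately show ?thesis using a a0 by auto
  qed
  have T_scale: "T (a \<otimes> b) \<in> J" if J: "right_ideal J ?S" and a: "T a \<in> J" "a \<in> carrier R" "b \<in> carrier R"
    for J a b
  proof -
    let ?u = "\<lambda>m\<in>?C. b \<odot>\<^bsub>M\<^esub> m"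
    have "endo_on ?C (\<lambda>m. b \<odot>\<^bsub>M\<^esub> m)" using a(3) by (auto simp: endo_on_def lin_simps)
    then have "?u \<in> carrier ?S" using endo_on_restrict by (simp add: End_ring_def)
    then have "T a \<otimes>\<^bsub>?S\<^esub> ?u \<in> J" using J a(1) by (simp add: right_ideal_def)
    moreover have "T a \<otimes>\<^bsub>?S\<^esub> ?u = T (a \<otimes> b)"
      using a k pD by (auto simp: End_ring_def compose_def T_def lin_simps intro!: restrict_ext)
    ultimately show ?thesis by simp
  qed
  \<comment> \<open>\<open>T \<one>\<close> is the complementary idempotent, so the annihilator is
    non-zero.\<close>
  have "T \<one> \<in> ?A"
  proof -
    have "project p k (p m \<odot>\<^bsub>M\<^esub> k) = \<zero>\<^bsub>M\<^esub>" if "m \<in> ?C" for m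
      unfolding project_def using pD(1)[OF that] pD(3)[OF pD(1)[OF that] k] k p(2) by (simp add: lin_simps)
    then have "compose ?C ?e (T \<one>) = (\<lambda>m\<in>?C. \<zero>\<^bsub>M\<^esub>)"
      using k pD(1) by (auto simp: compose_def T_def intro!: restrict_ext)
    then show ?thesis using TS by (simp add: right_annihilator_def End_ring_def)
  qed
  then have "?A \<noteq> {\<zero>\<^bsub>?S\<^esub>}" using T0[of \<one>] by auto
  moreover have "\<not> (\<exists>J K. right_ideal J ?S \<and> right_ideal K ?S \<and> J \<noteq> {\<zero>\<^bsub>?S\<^esub>} \<and> K \<noteq> {\<zero>\<^bsub>?S\<^esub>} \<and>
         J \<inter> K = {\<zero>\<^bsub>?S\<^esub>} \<and> J <+>\<^bsub>?S\<^esub> K = ?A)"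
  proof
    assume "\<exists>J K. right_ideal J ?S \<and> right_ideal K ?S \<and> J \<noteq> {\<zero>\<^bsub>?S\<^esub>} \<and> K \<noteq> {\<zero>\<^bsub>?S\<^esub>} \<and>
         J \<inter> K = {\<zero>\<^bsub>?S\<^esub>} \<and> J <+>\<^bsub>?S\<^esub> K = ?A"
    then obtain J K where J: "right_ideal J ?S" "J \<noteq> {\<zero>\<^bsub>?S\<^esub>}" and K: "right_ideal K ?S" "K \<noteq> {\<zero>\<^bsub>?S\<^esub>}"
      and JK: "J \<inter> K = {\<zero>\<^bsub>?S\<^esub>}" "J <+>\<^bsub>?S\<^esub> K = ?A" by blast
    interpret J: additive_subgroup J ?S using J(1) by (simp add: right_ideal_def)
    interpret K: additive_subgroup K ?S using K(1) by (simp add: right_ideal_def)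
    have "j \<in> J <+>\<^bsub>?S\<^esub> K" if j: "j \<in> J" for j
    proof -
      have "j \<oplus>\<^bsub>?S\<^esub> \<zero>\<^bsub>?S\<^esub> \<in> J <+>\<^bsub>?S\<^esub> K"
        unfolding set_add_def' using j K.zero_closed by blast
      then show ?thesis using S.r_zero[OF J.a_Hcarr[OF j]] by simp
    qed
    then obtain a where a: "a \<in> carrier R" "a \<noteq> \<zero>" "T a \<in> J" using T_mem[OF J] JK(2) by blast
    have "j \<in> J <+>\<^bsub>?S\<^esub> K" if j: "j \<in> K" for j
    proof -
      have "\<zero>\<^bsub>?S\<^esub> \<oplus>\<^bsub>?S\<^esub> j \<in> J <+>\<^bsub>?S\<^esub> K"
        unfolding set_add_def' using j J.zero_closed by blast
      then show ?thesis using S.l_zero[OF K.a_Hcarr[OF j]] by simp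
    qed
    then obtain b where b: "b \<in> carrier R" "b \<noteq> \<zero>" "T b \<in> K" using T_mem[OF K] JK(2) by blast
    \<comment> \<open>Right multiplication by scalars brings this one map into both summands. It is
      non-zero in a domain, so the sum is not direct.\<close>
    have "T (a \<otimes> b) \<in> J" by (rule T_scale[OF J(1) a(3,1) b(1)])
    moreover have "T (a \<otimes> b) \<in> K"
      using T_scale[OF K(1) b(3,1) a(1)] a(1) b(1) by (simp add: R.m_comm)
    ultimately have "T (a \<otimes> b) = \<zero>\<^bsub>?S\<^esub>" using JK(1) by blast
    then show False using T0[of "a \<otimes> b"] a b integral by auto
  qed
  ultimately show ?thesis
    using e unfolding coprimitive_idempotent_def indecomposable_right_ideal_def by blast
qed

lemma foldr_End_ring_project:
  assumes "\<forall>pk\<in>set ps. split_pair (carrier M) pk"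
  shows "foldr (\<otimes>\<^bsub>End_ring R M\<^esub>) (map (\<lambda>(p, k). restrict (project p k) (carrier M)) ps) \<one>\<^bsub>End_ring R M\<^esub>
    = restrict (project_list ps) (carrier M)"
  using assms
proof (induction ps)
  case Nil
  then show ?case by (auto simp: End_ring_def intro!: restrict_ext)
next
  case (Cons pk ps)
  obtain p k where "pk = (p, k)" by fastforce
  moreover have "project_list ps m \<in> carrier M" if "m \<in> carrier M" for m
    using project_list_closed[OF carrier_is_submodule] Cons.prems that by simp
  ultimately show ?case
    using Cons by (auto simp: End_ring_def compose_def intro!: restrict_ext)
qed

end

section \<open>Discrete valuation domains\<close>

text \<open>After division by a gcd the cofactors are coprime. The prime generating the unique
  maximal ideal divides every non-unit, so it cannot divide both, and one cofactor is a
  unit.\<close>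

lemma (in discrete_valuation_domain) divides_total:
  assumes a: "a \<in> carrier R" and b: "b \<in> carrier R"
  shows "a divides b \<or> b divides a"
proof (cases "a = \<zero> \<or> b = \<zero>")
  case True
  then show ?thesis using a b divides_zero by blast
next
  case False
  obtain p where p: "p \<in> carrier R" "ring_prime p" and max: "{I. maximalideal I R} = {PIdl p}"
    using unique_maximalideal by blast
  have p_nonunit: "p \<notin> Units R" using ring_primeE[OF p] by (auto simp: prime_def)
  have p_div: "p divides c" if c: "c \<in> carrier R" "c \<notin> Units R" for c
  proof (cases "c = \<zero>")
    case True
    then show ?thesis using p divides_zero by blast
  next
    case False
    with c obtain q where q: "q \<in> carrier R" "ring_irreducible q" "q divides c"
      using exists_irreducible_divisor by blast
    \<comment> \<open>An irreducible divisor generates a maximal ideal, which must be the one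
      generated by \<open>p\<close>.\<close>
    have "maximalideal (PIdl q) R" by (rule irreducible_imp_maximalideal[OF q(1,2)])
    then have "PIdl q = PIdl p" using max by blast
    then have "p divides q" using to_contain_is_to_divide[OF p(1) q(1)] by blast
    then show ?thesis using divides_trans[OF _ q(3) p(1)] by blast
  qed
  obtain g where g: "g \<in> carrier R" and gI: "PIdl g = PIdl a <+>\<^bsub>R\<^esub> PIdl b"
    using exists_gen[OF add_ideals[OF cgenideal_ideal[OF a] cgenideal_ideal[OF b]]] by metis
  then have "g gcdof a b" using ideal_sum_iff_gcd[OF a b g] by blast
  then obtain a' b' where a': "a' \<in> carrier R" "a = g \<otimes> a'" and b': "b' \<in> carrier R" "b = g \<otimes> b'"
    unfolding isgcd_def factor_def by blast
  have "g \<in> PIdl a <+>\<^bsub>R\<^esub> PIdl b" using cgenideal_self[OF g] gI by simp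
  then obtain x y where xy: "x \<in> carrier R" "y \<in> carrier R" "g = x \<otimes> a \<oplus> y \<otimes> b"
    unfolding set_add_def' cgenideal_def by blast
  \<comment> \<open>Cancelling \<open>g\<close> from Bezout's relation yields one as a combination
    of the cofactors.\<close>
  have "g \<otimes> \<one> = g \<otimes> (x \<otimes> a' \<oplus> y \<otimes> b')"
  proof -
    have "x \<otimes> a \<oplus> y \<otimes> b = g \<otimes> (x \<otimes> a' \<oplus> y \<otimes> b')"
      unfolding a'(2) b'(2) using g a'(1) b'(1) xy(1,2) by (simp add: r_distr m_ac)
    then show ?thesis using xy(3) g by simp
  qed
  moreover have "g \<noteq> \<zero>" using False a' b' by auto
  ultimately have one: "\<one> = x \<otimes> a' \<oplus> y \<otimes> b'"
    using m_lcancel[of g "\<one>" "x \<otimes> a' \<oplus> y \<otimes> b'"] g a'(1) b'(1) xy(1,2) by simp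
  have "a' \<in> Units R \<or> b' \<in> Units R"
  proof (rule ccontr)
    assume "\<not> ?thesis"
    then have "p divides a'" "p divides b'" using p_div a'(1) b'(1) by auto
    then obtain c d where c: "c \<in> carrier R" "a' = p \<otimes> c" and d: "d \<in> carrier R" "b' = p \<otimes> d"
      unfolding factor_def by blast
    have "x \<otimes> a' \<oplus> y \<otimes> b' = p \<otimes> (x \<otimes> c \<oplus> y \<otimes> d)"
      unfolding c(2) d(2) using p(1) c(1) d(1) xy(1,2) by (simp add: r_distr m_ac)
    then have "p divides \<one>" unfolding factor_def using one c(1) d(1) xy(1,2) by (metis a_closed m_closed)
    then show False using p_nonunit divides_one[OF p(1)] by simp
  qed
  then show ?thesis
  proof
    assume u: "a' \<in> Units R"
    have "a \<otimes> (inv a' \<otimes> b') = g \<otimes> (a' \<otimes> inv a') \<otimes> b'"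
      unfolding a'(2) using Units_inv_closed[OF u] g a'(1) b'(1) by (simp only: m_assoc m_closed)
    then have "b = a \<otimes> (inv a' \<otimes> b')" using u g b' by simp
    then have "a divides b" unfolding factor_def using u b'(1) by blast
    then show ?thesis ..
  next
    assume u: "b' \<in> Units R"
    have "b \<otimes> (inv b' \<otimes> a') = g \<otimes> (b' \<otimes> inv b') \<otimes> a'"
      unfolding b'(2) using Units_inv_closed[OF u] g a'(1) b'(1) by (simp only: m_assoc m_closed)
    then have "a = b \<otimes> (inv b' \<otimes> a')" using u g a' by simp
    then have "b divides a" unfolding factor_def using u a'(1) by blast
    then show ?thesis ..
  qed
qed

theorem theorem5p19:
  fixes R :: "('a, 'r) ring_scheme" and M :: "('a, 'b, 'm) module_scheme"
    and n :: nat and \<alpha> :: "'b \<Rightarrow> 'b"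
  assumes "discrete_valuation_domain R"
    and "module R M"
    and "free_of_rank R M n"
    and "n \<ge> 2"
    and "\<alpha> \<in> carrier (End_ring R M)"
    and "\<not> inj_on \<alpha> (carrier M)"
  shows "\<exists>es. es \<noteq> [] \<and> length es \<le> 2 * n - 2 \<and>
    (\<forall>e \<in> set es. coprimitive_idempotent (End_ring R M) e) \<and>
    \<alpha> = foldr (\<otimes>\<^bsub>End_ring R M\<^esub>) es \<one>\<^bsub>End_ring R M\<^esub>"
proof -
  interpret V: discrete_valuation_domain R by (rule assms(1))
  interpret module R M by (rule assms(2))
  interpret valuation_domain_module R M
    by unfold_locales (rule V.divides_total)
  have \<alpha>: "endo_on (carrier M) \<alpha>" "\<alpha> \<in> extensional (carrier M)"
    using assms(5) by (auto simp: End_ring_def module_endos_iff)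
  obtain x y where xy: "x \<in> carrier M" "y \<in> carrier M" "x \<noteq> y" "\<alpha> x = \<alpha> y"
    using assms(6) by (auto simp: inj_on_def)
  \<comment> \<open>Two vectors with equal image differ by a non-zero kernel vector.\<close>
  define v where "v = x \<oplus>\<^bsub>M\<^esub> \<ominus>\<^bsub>M\<^esub> y"
  have v: "v \<in> carrier M" using xy by (simp add: v_def)
  have "x = v \<oplus>\<^bsub>M\<^esub> y" using xy by (simp add: v_def lin_simps)
  then have "v \<noteq> \<zero>\<^bsub>M\<^esub>" using xy by auto
  moreover have "\<alpha> v = \<zero>\<^bsub>M\<^esub>"
    using xy endo_onD[OF \<alpha>(1)] endo_on_minus[OF carrier_is_submodule \<alpha>(1)]
    by (simp add: v_def M.r_neg)
  \<comment> \<open>The bound on \<open>n\<close> keeps the natural subtraction exact. The list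
    length \<open>2 * (n - 2) + 2\<close> is then \<open>2 * n - 2\<close>.\<close>
  moreover have "flag_rank (n - 2 + 2) (carrier M)" using flag_rank_carrier[OF assms(3)] assms(4) by (simp only: le_add_diff_inverse2)
  ultimately obtain ps where len: "length ps = 2 * (n - 2) + 2"
    and ps: "\<forall>pk\<in>set ps. split_pair (carrier M) pk"
    and eq: "\<forall>m\<in>carrier M. \<alpha> m = project_list ps m"
    using singular_product[OF carrier_is_submodule _ \<alpha>(1) v] by blast
  have "\<alpha> = restrict (project_list ps) (carrier M)"
    using eq \<alpha>(2) by (auto simp: extensional_def fun_eq_iff)
  then have "\<alpha> = foldr (\<otimes>\<^bsub>End_ring R M\<^esub>) (map (\<lambda>(p, k). restrict (project p k) (carrier M)) ps) \<one>\<^bsub>End_ring R M\<^esub>"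
    using foldr_End_ring_project[OF ps] by simp
  moreover have "\<forall>e\<in>set (map (\<lambda>(p, k). restrict (project p k) (carrier M)) ps).
      coprimitive_idempotent (End_ring R M) e"
    using ps coprimitive_project by auto
  moreover have "length ps \<le> 2 * n - 2" "ps \<noteq> []" using len assms(4) by auto
  ultimately show ?thesis
    by (intro exI[of _ "map (\<lambda>(p, k). restrict (project p k) (carrier M)) ps"]) simp
qed

end
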